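(* Consider the mixed random environment model with drift parameter $\delta \in (-1,1)$ described in the context. Suppose that the distribution of $\zeta_0$ is symmetric about $0$, i.e. $\mathbb{P}[\zeta_0 \le -x] = \mathbb{P}[\zeta_0 \ge x]$ for all $x \ge 0$, and that for some $\alpha \in (1,2)$ and some $c \in (0,\infty)$, $\mathbb{P}[\zeta_0 > r] \sim c r^{-\alpha}$ as $r \to \infty$. Suppose that $\phi(n) = n^{-\beta}$ for all $n \ge 1$ (with $\phi(0) \in [0,1]$ arbitrary), where $\beta \in (0,1)$. (i) Suppose that $\beta < 1 - \frac{1}{\alpha}$. If $\delta < 0$, then $X$ is recurrent for $\mathbb{P}$-a.e. $\omega$. If $\delta > 0$, then $X$ is transient for $\mathbb{P}$-a.e. $\omega$. (ii) Suppose that $\beta > 1 - \frac{1}{\alpha}$. Then (for any $\delta \in (-1,1)$) $X$ is recurrent for $\mathbb{P}$-a.e. $\omega$.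
   Context: Random environment. Let $\mathbb{Z}_+ = \{0,1,2,\ldots\}$. Fix $\delta \in (-1,1)$ and a function $\phi : \mathbb{Z}_+ \to [0,1]$. On a probability space $(\Omega,\mathcal{F},\mathbb{P})$ (with expectation $\mathbb{E}$), let $\chi_0,\chi_1,\ldots$ be independent $\{0,1\}$-valued random variables with $\mathbb{P}[\chi_n = 1] = \phi(n)$, and let $\xi_0,\xi_1,\ldots$ be i.i.d. $(0,1)$-valued random variables, independent of the $\chi_i$. Set $p_n = \frac{1-\delta}{2}\chi_n + \xi_n(1-\chi_n)$, $q_n = 1-p_n$, and $\zeta_n = \log\left(\frac{\xi_n}{1-\xi_n}\right)$. The environment is $\omega = (p_0,p_1,p_2,\ldots)$. Random walk. For fixed $\omega$, under the quenched law $P_\omega$, $X = (X_t)_{t \in \mathbb{Z}_+}$ is the Markov chain on $\mathbb{Z}_+$ with $X_0 = 0$ and, for $n \ge 1$, $P_\omega[X_{t+1} = n-1 \mid X_t = n] = p_n$ and $P_\omega[X_{t+1} = n+1 \mid X_t = n] = q_n$; and $P_\omega[X_{t+1} = 0 \mid X_t = 0] = p_0$, $P_\omega[X_{t+1} = 1 \mid X_t = 0] = q_0$. It is irreducible and aperiodic. "Recurrent" and "transient" refer to this Markov chain under $P_\omega$. The notation $\sim$ means that the ratio of the two sides tends to $1$. *)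

theory Defs
  imports "HOL-Probability.Probability" "HOL-Library.Landau_Symbols"
begin

section \<open>Time-homogeneous Markov chains with discrete state space\<close>

text \<open>
  The kernel of the \<open>t\<close>-th coordinate given the path up to time \<open>t - 1\<close>, in the format of the
  Ionescu-Tulcea theorem, for the chain with transition kernel \<open>K\<close> and initial state \<open>x\<close>.
\<close>

definition chain_step ::
  "('s \<Rightarrow> 's pmf) \<Rightarrow> 's \<Rightarrow> nat \<Rightarrow> (nat \<Rightarrow> 's) \<Rightarrow> 's measure" where
  "chain_step K x t X =
     (case t of 0 \<Rightarrow> measure_pmf (return_pmf x) | Suc s \<Rightarrow> measure_pmf (K (X s)))"

lemma Ionescu_Tulcea_chain_step:
  "Ionescu_Tulcea (chain_step K x) (\<lambda>_. count_space UNIV)"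
proof (rule Ionescu_Tulcea.intro)
  fix t :: nat
  show "chain_step K x t \<in> PiM {0..<t} (\<lambda>_. count_space UNIV) \<rightarrow>\<^sub>M subprob_algebra (count_space UNIV)"
  proof (cases t)
    case 0
    then have "chain_step K x t = (\<lambda>_. measure_pmf (return_pmf x))"
      by (simp add: chain_step_def fun_eq_iff)
    then show ?thesis
      by (simp only:) (intro measurable_const measure_pmf_in_subprob_algebra)
  next
    case (Suc s)
    have "(\<lambda>y. measure_pmf (K y)) \<in> count_space UNIV \<rightarrow>\<^sub>M subprob_algebra (count_space UNIV)"
      by (simp add: measure_pmf_in_subprob_algebra)
    moreover have "(\<lambda>X. X s) \<in> PiM {0..<t} (\<lambda>_. count_space UNIV) \<rightarrow>\<^sub>M count_space UNIV"
      using Suc by (intro measurable_component_singleton) auto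
    ultimately have "(\<lambda>X. measure_pmf (K (X s))) \<in>
        PiM {0..<t} (\<lambda>_. count_space UNIV) \<rightarrow>\<^sub>M subprob_algebra (count_space UNIV)"
      by (rule measurable_compose[rotated])
    moreover have "chain_step K x t = (\<lambda>X. measure_pmf (K (X s)))"
      using Suc by (simp add: chain_step_def fun_eq_iff)
    ultimately show ?thesis
      by (simp only:)
  qed
next
  fix t X
  show "prob_space (chain_step K x t X)"
    by (cases t) (simp_all only: chain_step_def nat.case prob_space_measure_pmf)
qed

text \<open>
  Law, on the path space with its product sigma-algebra, of the Markov chain started in \<open>x\<close>.
\<close>

definition chain_law :: "('s \<Rightarrow> 's pmf) \<Rightarrow> 's \<Rightarrow> (nat \<Rightarrow> 's) measure" where
  "chain_law K x =
     projective_family.lim UNIV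
       (Ionescu_Tulcea.CI (chain_step K x) (\<lambda>_. count_space UNIV)) (\<lambda>_. count_space UNIV)"

definition recurrent_chain :: "('s \<Rightarrow> 's pmf) \<Rightarrow> bool" where
  "recurrent_chain K \<longleftrightarrow>
     (\<forall>x. measure (chain_law K x) {X \<in> space (chain_law K x). \<exists>t\<ge>1. X t = x} = 1)"

definition transient_chain :: "('s \<Rightarrow> 's pmf) \<Rightarrow> bool" where
  "transient_chain K \<longleftrightarrow>
     (\<forall>x. measure (chain_law K x) {X \<in> space (chain_law K x). \<exists>t\<ge>1. X t = x} < 1)"

lemma sets_chain_law: "sets (chain_law K x) = sets (PiM UNIV (\<lambda>_. count_space UNIV))"
proof -
  interpret Ionescu_Tulcea "chain_step K x" "\<lambda>_. count_space UNIV"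
    by (rule Ionescu_Tulcea_chain_step)
  show ?thesis
    unfolding chain_law_def by (rule PF.sets_lim)
qed

lemma space_chain_law: "space (chain_law K x) = UNIV"
  using sets_eq_imp_space_eq[OF sets_chain_law] by (simp add: space_PiM)

lemma emeasure_chain_law_cylinder:
  "emeasure (chain_law K x) {X. \<forall>i\<le>n. X i = xs i} =
     ennreal (indicator {x} (xs 0) * (\<Prod>i<n. pmf (K (xs i)) (xs (Suc i))))"
proof -
  interpret Ionescu_Tulcea "chain_step K x" "\<lambda>_. count_space UNIV"
    by (rule Ionescu_Tulcea_chain_step)
  let ?S = "\<lambda>_::nat. count_space (UNIV :: 'a set)"
  let ?A = "\<lambda>n. PiE {0..<n} (\<lambda>i. {xs i})"
  let ?w = "\<lambda>n. restrict xs {0..<n}"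
  have A_sets [measurable]: "?A n \<in> sets (PiM {0..<n} ?S)" for n
    by (intro sets_PiM_I_finite) auto
  have A_eq: "?A n = {?w n}" for n
    by (auto simp: PiE_iff extensional_def fun_eq_iff)
  have w [simp]: "?w n \<in> space (PiM {0..<n} ?S)" for n
    by (auto simp: space_PiM)
  have step: "C 0 (Suc n) (\<lambda>_. undefined) (?A (Suc n)) =
      C 0 n (\<lambda>_. undefined) (?A n) * chain_step K x n (?w n) {xs n}" for n
  proof -
    have "C 0 (Suc n) (\<lambda>_. undefined) (?A (Suc n)) =
        (\<integral>\<^sup>+X. eP n X (?A (Suc n)) \<partial>C 0 n (\<lambda>_. undefined))"
      using prob_space.not_empty[OF prob_space_C[of "\<lambda>_. undefined" 0 n]]
      by (simp, subst emeasure_bind[where N="PiM {0..<Suc n} ?S"])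
         (auto simp: measurable_cong_sets[OF sets_C] space_PiM
               intro: measurable_eP[of n, simplified])
    also have "\<dots> = (\<integral>\<^sup>+X. chain_step K x n (?w n) {xs n} * indicator (?A n) X \<partial>C 0 n (\<lambda>_. undefined))"
    proof (intro nn_integral_cong)
      fix X assume "X \<in> space (C 0 n (\<lambda>_. undefined))"
      then have X: "X \<in> space (PiM {0..<n} ?S)"
        by (subst (asm) space_C) (auto simp: space_PiM)
      have "eP n X (?A (Suc n)) =
          chain_step K x n X ((\<lambda>y. X(n := y)) -` ?A (Suc n) \<inter> space (count_space UNIV))"
        by (intro emeasure_eP X A_sets)
      also have "(\<lambda>y. X(n := y)) -` ?A (Suc n) \<inter> space (count_space UNIV) =
          (if X \<in> ?A n then {xs n} else {})"
        using X by (auto simp: PiE_iff space_PiM extensional_def less_Suc_eq split: if_splits)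
      finally have eP: "eP n X (?A (Suc n)) = chain_step K x n X (if X \<in> ?A n then {xs n} else {})" .
      show "eP n X (?A (Suc n)) = chain_step K x n (?w n) {xs n} * indicator (?A n) X"
      proof (cases "X \<in> ?A n")
        case True
        then have "?w n = X"
          unfolding A_eq by (rule singletonD[symmetric])
        then show ?thesis
          unfolding eP using True by simp
      next
        case False
        then show ?thesis
          unfolding eP by simp
      qed
    qed
    also have "\<dots> = C 0 n (\<lambda>_. undefined) (?A n) * chain_step K x n (?w n) {xs n}"
      by (subst nn_integral_cmult_indicator) (auto simp: sets_C space_PiM mult.commute)
    finally show ?thesis .
  qed
  have C: "C 0 (Suc n) (\<lambda>_. undefined) (?A (Suc n)) =
      ennreal (indicator {x} (xs 0) * (\<Prod>i<n. pmf (K (xs i)) (xs (Suc i))))" for n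
  proof (induction n)
    case 0
    have "C 0 0 (\<lambda>_. undefined) (?A 0) = 1"
      using A_sets[of 0] by (simp add: emeasure_return)
    then show ?case
      by (subst step) (auto simp: chain_step_def emeasure_pmf_single split: split_indicator)
  next
    case (Suc n)
    have "emeasure (chain_step K x (Suc n) (?w (Suc n))) {xs (Suc n)} = ennreal (pmf (K (xs n)) (xs (Suc n)))"
      by (simp add: chain_step_def emeasure_pmf_single)
    then show ?case
      by (subst step, subst Suc.IH)
         (simp only: prod.lessThan_Suc mult.assoc ennreal_mult''[symmetric] pmf_nonneg)
  qed
  have "{X. \<forall>i\<le>n. X i = xs i} = PF.emb UNIV {0..<Suc n} (?A (Suc n))"
    by (auto simp: prod_emb_def space_PiM PiE_iff less_Suc_eq_le)
  then have "emeasure (chain_law K x) {X. \<forall>i\<le>n. X i = xs i} = CI {0..<Suc n} (?A (Suc n))"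
    unfolding chain_law_def by (simp only: lim[OF finite_atLeastLessThan A_sets[of "Suc n"]])
  also have "\<dots> = C 0 (Suc n) (\<lambda>_. undefined) (PF.emb {0..<Suc n} {0..<Suc n} (?A (Suc n)))"
    by (rule emeasure_CI[OF subset_refl A_sets])
  also have "PF.emb {0..<Suc n} {0..<Suc n} (?A (Suc n)) = ?A (Suc n)"
    by (rule prod_emb_id) (auto simp: PiE_iff)
  finally show ?thesis
    by (simp only: C)
qed


section \<open>Random walk in a mixed random environment\<close>

text \<open>
  One step of the walk in the environment \<open>p\<close>: from \<open>n\<close> to \<open>n - 1\<close> with probability \<open>p n\<close>, to
  \<open>n + 1\<close> with probability \<open>1 - p n\<close>.  Truncated subtraction makes the walk stay at \<open>0\<close> with
  probability \<open>p 0\<close>.  (The library clips the parameter of a Bernoulli distribution to the unit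
  interval; the environments below take values there.)
\<close>

definition walk_kernel :: "(nat \<Rightarrow> real) \<Rightarrow> nat \<Rightarrow> nat pmf" where
  "walk_kernel p n = map_pmf (\<lambda>left. if left then n - 1 else n + 1) (bernoulli_pmf (p n))"

definition env ::
  "real \<Rightarrow> (nat \<Rightarrow> 'a \<Rightarrow> real) \<Rightarrow> (nat \<Rightarrow> 'a \<Rightarrow> real) \<Rightarrow> 'a \<Rightarrow> nat \<Rightarrow> real" where
  "env \<delta> chi xi \<omega> n = (1 - \<delta>) / 2 * chi n \<omega> + xi n \<omega> * (1 - chi n \<omega>)"

definition zeta :: "(nat \<Rightarrow> 'a \<Rightarrow> real) \<Rightarrow> nat \<Rightarrow> 'a \<Rightarrow> real" where
  "zeta xi n \<omega> = ln (xi n \<omega> / (1 - xi n \<omega>))"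

locale mixed_environment = prob_space M
  for M :: "'a measure" +
  fixes \<delta> :: real and \<phi> :: "nat \<Rightarrow> real" and chi xi :: "nat \<Rightarrow> 'a \<Rightarrow> real"
  assumes delta: "\<delta> \<in> {-1<..<1}"
    and phi: "\<And>n. \<phi> n \<in> {0..1}"
    and chi_values: "\<And>n \<omega>. \<omega> \<in> space M \<Longrightarrow> chi n \<omega> \<in> {0, 1}"
    and chi_indep: "indep_vars (\<lambda>_. borel) chi UNIV"
    and chi_prob: "\<And>n. prob {\<omega> \<in> space M. chi n \<omega> = 1} = \<phi> n"
    and xi_values: "\<And>n \<omega>. \<omega> \<in> space M \<Longrightarrow> xi n \<omega> \<in> {0<..<1}"
    and xi_indep: "indep_vars (\<lambda>_. borel) xi UNIV"
    and xi_ident: "\<And>n. distr M borel (xi n) = distr M borel (xi 0)"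
    and chi_xi_indep:
      "indep_var (PiM UNIV (\<lambda>_. borel)) (\<lambda>\<omega> n. chi n \<omega>) (PiM UNIV (\<lambda>_. borel)) (\<lambda>\<omega> n. xi n \<omega>)"

end

(*
  With log (p_n / q_n) = lambda chi_n + (1 - chi_n) zeta_n, where lambda = log ((1 - delta) / (1 + delta)),
  and S_n the partial sums, the walk is recurrent iff the sum of exp(S_n) diverges.

  The drift part of S_n is of order lambda n^(1 - beta), the symmetric heavy-tailed part of order
  n^(1 / alpha).  If the drift dominates, choose 1 / alpha < g < 1 - beta and truncate zeta_i at i^g,
  which changes only finitely many terms.  The truncated variables are centred by symmetry, so the
  exponential Markov inequality with parameter n^(-g) and Borel-Cantelli give |S_n| >= n^g - O(1)
  eventually, with the sign of lambda.

  If the fluctuations dominate, choose 1 - beta < g < 1 / alpha.  The characteristic function of the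
  symmetric part T_n tends to 0 at multiples of n^(-g), so |T_n| <= n^g has probability bounded away
  from 1; by symmetry T_n > n^g, and hence S_n >= 0, has probability bounded below.  By Kolmogorov's
  0-1 law, almost surely S_n does not tend to minus infinity.
*)

theory Submission
  imports Defs "HOL-Real_Asymp.Real_Asymp"
begin

section \<open>The first-step decomposition of the path law\<close>

lemma sets_PiM_cylinders:
  "sets (PiM UNIV (\<lambda>_::nat. count_space (UNIV :: 's::countable set))) =
     sigma_sets UNIV {{X. \<forall>i\<le>n. X i = xs i} |n xs. True}"
    (is "_ = sigma_sets _ ?E")
proof (intro equalityI)
  have "sets (PiM UNIV (\<lambda>_::nat. count_space (UNIV :: 's set))) =
      sigma_sets UNIV {{X. X i \<in> A} |i A. True}"
    by (subst sets_PiM_single) simp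
  also have "\<dots> \<subseteq> sigma_sets UNIV ?E"
  proof (rule sigma_sets_mono, safe)
    fix i :: nat and A :: "'s set"
    have "{X. X i \<in> A} = (\<Union>l\<in>{l::'s list. length l = Suc i \<and> l ! i \<in> A}. {X. \<forall>j\<le>i. X j = l ! j})"
    proof (intro equalityI subsetI)
      fix X assume "X \<in> {X. X i \<in> A}"
      then show "X \<in> (\<Union>l\<in>{l::'s list. length l = Suc i \<and> l ! i \<in> A}. {X. \<forall>j\<le>i. X j = l ! j})"
        by (intro UN_I[of "map X [0..<Suc i]"]) (auto simp: less_Suc_eq_le simp del: upt_Suc)
    qed auto
    also have "\<dots> \<in> sigma_sets UNIV ?E"
      by (intro sigma_sets_UNION countable_image) (auto intro!: sigma_sets.Basic)
    finally show "{X. X i \<in> A} \<in> sigma_sets UNIV ?E" .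
  qed
  finally show "sets (PiM UNIV (\<lambda>_::nat. count_space (UNIV :: 's set))) \<subseteq> sigma_sets UNIV ?E" .
  show "sigma_sets UNIV ?E \<subseteq> sets (PiM UNIV (\<lambda>_::nat. count_space (UNIV :: 's set)))"
  proof -
    have "{X. \<forall>i\<le>n. X i = xs i} \<in> sets (PiM UNIV (\<lambda>_::nat. count_space UNIV))"
      for n and xs :: "nat \<Rightarrow> 's"
    proof -
      have "{X \<in> space (PiM UNIV (\<lambda>_::nat. count_space UNIV)). \<forall>i\<in>{..n}. X i = xs i}
          \<in> sets (PiM UNIV (\<lambda>_::nat. count_space UNIV))"
        by measurable
      then show ?thesis by (simp add: space_PiM Ball_def)
    qed
    then have "?E \<subseteq> sets (PiM UNIV (\<lambda>_::nat. count_space (UNIV :: 's set)))" by blast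
    from sets.sigma_sets_subset[OF this] show ?thesis by (simp add: space_PiM)
  qed
qed

lemma measure_eqI_cylinders:
  fixes N N' :: "(nat \<Rightarrow> 's::countable) measure"
  assumes sets: "sets N = sets (PiM UNIV (\<lambda>_. count_space UNIV))"
    "sets N' = sets (PiM UNIV (\<lambda>_. count_space UNIV))"
    and eq: "\<And>n xs. emeasure N {X. \<forall>i\<le>n. X i = xs i} = emeasure N' {X. \<forall>i\<le>n. X i = xs i}"
    and fin: "finite_measure N"
  shows "N = N'"
proof -
  interpret finite_measure N by fact
  let ?E = "insert {} {{X. \<forall>i\<le>n. X i = xs i} |n (xs :: nat \<Rightarrow> 's). True}"
  have E: "sigma_sets UNIV ?E = sigma_sets UNIV {{X. \<forall>i\<le>n. X i = xs i} |n (xs :: nat \<Rightarrow> 's). True}"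
    by (intro sigma_sets_eqI) (auto intro: sigma_sets.Basic sigma_sets.Empty)
  have int: "{X. \<forall>i\<le>n. X i = xs i} \<inter> {X. \<forall>i\<le>m. X i = ys i} \<in> ?E"
    for n m and xs ys :: "nat \<Rightarrow> 's"
  proof (cases "\<forall>i\<le>min n m. xs i = ys i")
    case True
    have "{X. \<forall>i\<le>n. X i = xs i} \<inter> {X. \<forall>i\<le>m. X i = ys i} =
        {X. \<forall>i\<le>max n m. X i = (if n \<ge> m then xs else ys) i}"
      using True by (auto simp: max_def min_def split: if_splits)
    then show ?thesis by blast
  next
    case False
    then obtain i where "i \<le> n" "i \<le> m" "xs i \<noteq> ys i" by auto
    then have "{X. \<forall>i\<le>n. X i = xs i} \<inter> {X. \<forall>i\<le>m. X i = ys i} = {}"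
      by (auto dest!: spec[of _ i])
    then show ?thesis by simp
  qed
  show ?thesis
  proof (rule measure_eqI_generator_eq[where E = ?E and \<Omega> = UNIV
        and A = "\<lambda>k. {X. \<forall>i\<le>0. X i = (from_nat k :: 's)}"])
    show "Int_stable ?E"
    proof (unfold Int_stable_def, intro ballI)
      fix a b assume "a \<in> ?E" "b \<in> ?E"
      then consider "a \<inter> b = {}" | n xs m ys
        where "a = {X. \<forall>i\<le>n. X i = xs i}" "b = {X. \<forall>i\<le>m. X i = ys i}"
        by blast
      then show "a \<inter> b \<in> ?E"
        by cases (simp, simp only: int)
    qed
    show "(\<Union>k. {X. \<forall>i\<le>0::nat. X i = (from_nat k :: 's)}) = UNIV"
      by (auto, metis from_nat_to_nat)
  qed (auto simp: sets sets_PiM_cylinders E[simplified] eq[simplified] intro!: exI[of _ 0])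
qed

lemma all_le_Suc_iff: "(\<forall>i\<le>Suc m. P i) \<longleftrightarrow> P 0 \<and> (\<forall>i\<le>m. P (Suc i))"
  by (metis Suc_le_mono not0_implies_Suc zero_le)

lemma ex_case_nat:
  "(\<exists>t. case_nat y X t = x) \<longleftrightarrow> y = x \<or> (\<exists>t. X t = x)"
  "(\<exists>t\<ge>1. case_nat y X t = x) \<longleftrightarrow> (\<exists>t. X t = x)"
  "(\<exists>t\<le>Suc n. case_nat y X t = x) \<longleftrightarrow> y = x \<or> (\<exists>t\<le>n. X t = x)"
proof -
  have *: "(\<exists>t. P t) \<longleftrightarrow> P 0 \<or> (\<exists>t. P (Suc t))" for P :: "nat \<Rightarrow> bool"
    by (metis not0_implies_Suc)
  show "(\<exists>t. case_nat y X t = x) \<longleftrightarrow> y = x \<or> (\<exists>t. X t = x)"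
    "(\<exists>t\<ge>1. case_nat y X t = x) \<longleftrightarrow> (\<exists>t. X t = x)"
    "(\<exists>t\<le>Suc n. case_nat y X t = x) \<longleftrightarrow> y = x \<or> (\<exists>t\<le>n. X t = x)"
    by (subst *, simp)+
qed

lemma prob_space_chain_law: "prob_space (chain_law K x)"
proof -
  interpret Ionescu_Tulcea "chain_step K x" "\<lambda>_. count_space UNIV"
    by (rule Ionescu_Tulcea_chain_step)
  show ?thesis
  proof
    let ?S = "\<lambda>_::nat. count_space (UNIV :: 'a set)"
    interpret CI: prob_space "CI {}"
      by (rule PF.prob_space_P) simp_all
    have "emeasure PF.lim (PF.emb UNIV {} (space (PiM {} ?S))) = CI {} (space (PiM {} ?S))"
      by (intro lim) simp_all
    also have "\<dots> = 1"
      using CI.emeasure_space_1 sets_eq_imp_space_eq[OF PF.sets_P, of "{}"] by simp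
    also have "PF.emb UNIV {} (space (PiM {} ?S)) = space PF.lim"
      using sets_eq_imp_space_eq[OF PF.sets_lim] by (auto simp: prod_emb_def space_PiM)
    finally show "emeasure (chain_law K x) (space (chain_law K x)) = 1"
      unfolding chain_law_def .
  qed
qed

lemma measurable_chain_law_cong:
  "measurable (chain_law K x) N = measurable (PiM UNIV (\<lambda>_. count_space UNIV)) N"
  by (rule measurable_cong_sets) (simp_all add: sets_chain_law)

lemma measurable_case_nat_chain_law:
  "case_nat x \<in> chain_law K y \<rightarrow>\<^sub>M PiM UNIV (\<lambda>_. count_space UNIV)"
  unfolding measurable_chain_law_cong
proof (rule measurable_PiM_single')
  show "(\<lambda>X. case_nat x X i) \<in> PiM UNIV (\<lambda>_. count_space UNIV) \<rightarrow>\<^sub>M count_space UNIV" for i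
    by (cases i) simp_all
qed (simp add: space_PiM)

lemma measurable_distr_case_nat:
  "(\<lambda>y. distr (chain_law K y) (PiM UNIV (\<lambda>_. count_space UNIV)) (case_nat x))
     \<in> measure_pmf \<mu> \<rightarrow>\<^sub>M subprob_algebra (PiM UNIV (\<lambda>_. count_space UNIV))"
proof -
  have "distr (chain_law K y) (PiM UNIV (\<lambda>_. count_space UNIV)) (case_nat x)
      \<in> space (subprob_algebra (PiM UNIV (\<lambda>_. count_space UNIV)))" for y
    unfolding space_subprob_algebra
    by (intro CollectI conjI prob_space_imp_subprob_space sets_distr
        prob_space.prob_space_distr[OF prob_space_chain_law measurable_case_nat_chain_law])
  then show ?thesis by simp
qed

lemma chain_law_Markov:
  fixes K :: "'s::countable \<Rightarrow> 's pmf"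
  defines "S \<equiv> PiM UNIV (\<lambda>_::nat. count_space (UNIV :: 's set))"
  shows "chain_law K x = measure_pmf (K x) \<bind> (\<lambda>y. distr (chain_law K y) S (case_nat x))"
proof -
  note case_nat_meas = measurable_case_nat_chain_law[where 'a = 's, folded S_def]
  note sub = measurable_distr_case_nat[where 'a = 's, folded S_def]
  show ?thesis
  proof (rule measure_eqI_cylinders)
    show "sets (measure_pmf (K x) \<bind> (\<lambda>y. distr (chain_law K y) S (case_nat x))) =
        sets (PiM UNIV (\<lambda>_. count_space UNIV))"
      by (subst sets_bind[where N = S]) (simp_all add: S_def)
    show "finite_measure (chain_law K x)"
      using prob_space_chain_law by (rule prob_space.finite_measure)
    fix n :: nat and xs :: "nat \<Rightarrow> 's"
    have cyl: "{X. \<forall>i\<le>n. X i = ys i} \<in> sets S" for n and ys :: "nat \<Rightarrow> 's"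
      unfolding S_def sets_PiM_cylinders by (auto intro!: sigma_sets.Basic)
    have "emeasure (measure_pmf (K x) \<bind> (\<lambda>y. distr (chain_law K y) S (case_nat x))) {X. \<forall>i\<le>n. X i = xs i} =
        (\<integral>\<^sup>+y. emeasure (chain_law K y) (case_nat x -` {X. \<forall>i\<le>n. X i = xs i}) \<partial>K x)"
      by (subst emeasure_bind[OF _ sub cyl])
        (auto simp: emeasure_distr[OF case_nat_meas cyl] space_chain_law)
    also have "\<dots> = emeasure (chain_law K x) {X. \<forall>i\<le>n. X i = xs i}"
    proof (cases n)
      case 0
      have "emeasure (chain_law K y) UNIV = 1" for y
        using prob_space.emeasure_space_1[OF prob_space_chain_law[of K y]] by (simp add: space_chain_law)
      then have "(\<integral>\<^sup>+y. emeasure (chain_law K y) (case_nat x -` {X. \<forall>i\<le>n. X i = xs i}) \<partial>K x) = indicator {x} (xs 0)"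
        using 0 by (auto simp: measure_pmf.emeasure_space_1 split: split_indicator)
      then show ?thesis
        using 0 by (simp only: emeasure_chain_law_cylinder) (simp split: split_indicator)
    next
      case (Suc m)
      have "case_nat x -` {X. \<forall>i\<le>n. X i = xs i} =
          (if x = xs 0 then {X. \<forall>i\<le>m. X i = xs (Suc i)} else {})"
        unfolding Suc by (auto simp: all_le_Suc_iff)
      then have "(\<integral>\<^sup>+y. emeasure (chain_law K y) (case_nat x -` {X. \<forall>i\<le>n. X i = xs i}) \<partial>K x) =
          (\<integral>\<^sup>+y. indicator {x} (xs 0) * ennreal (\<Prod>i<m. pmf (K (xs (Suc i))) (xs (Suc (Suc i)))) *
             indicator {xs (Suc 0)} y \<partial>K x)"
        by (intro nn_integral_cong)
          (auto simp: emeasure_chain_law_cylinder[where xs = "\<lambda>i. xs (Suc i)"] split: split_indicator)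
      also have "\<dots> = indicator {x} (xs 0) * ennreal (\<Prod>i<m. pmf (K (xs (Suc i))) (xs (Suc (Suc i)))) *
          ennreal (pmf (K x) (xs (Suc 0)))"
        by (subst nn_integral_cmult_indicator) (simp_all add: emeasure_pmf_single)
      also have "\<dots> = emeasure (chain_law K x) {X. \<forall>i\<le>n. X i = xs i}"
        unfolding emeasure_chain_law_cylinder Suc prod.lessThan_Suc_shift
        by (auto simp: ennreal_mult' prod_nonneg mult_ac split: split_indicator)
      finally show ?thesis .
    qed
    finally show "emeasure (chain_law K x) {X. \<forall>i\<le>n. X i = xs i} =
        emeasure (measure_pmf (K x) \<bind> (\<lambda>y. distr (chain_law K y) S (case_nat x))) {X. \<forall>i\<le>n. X i = xs i}"
      by simp
  qed (rule sets_chain_law)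
qed

lemma emeasure_chain_law_first_step:
  fixes K :: "'s::countable \<Rightarrow> 's pmf"
  assumes B: "B \<in> sets (PiM UNIV (\<lambda>_::nat. count_space UNIV))"
  shows "emeasure (chain_law K x) B = (\<integral>\<^sup>+y. emeasure (chain_law K y) (case_nat x -` B) \<partial>K x)"
proof -
  let ?S = "PiM UNIV (\<lambda>_::nat. count_space (UNIV :: 's set))"
  have "emeasure (chain_law K x) B =
      (\<integral>\<^sup>+y. emeasure (distr (chain_law K y) ?S (case_nat x)) B \<partial>K x)"
    by (subst chain_law_Markov, subst emeasure_bind[OF _ measurable_distr_case_nat B]) simp_all
  also have "\<dots> = (\<integral>\<^sup>+y. emeasure (chain_law K y) (case_nat x -` B) \<partial>K x)"
    by (simp add: emeasure_distr[OF measurable_case_nat_chain_law B] space_chain_law)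
  finally show ?thesis .
qed

lemma measure_walk_first_step:
  assumes p: "p n \<in> {0..1}" and B: "B \<in> sets (PiM UNIV (\<lambda>_::nat. count_space UNIV))"
  shows "measure (chain_law (walk_kernel p) n) B =
    p n * measure (chain_law (walk_kernel p) (n - 1)) (case_nat n -` B) +
    (1 - p n) * measure (chain_law (walk_kernel p) (n + 1)) (case_nat n -` B)"
proof -
  let ?L = "chain_law (walk_kernel p)"
  have fin: "emeasure (?L k) A = ennreal (measure (?L k) A)" for k A
    by (rule finite_measure.emeasure_eq_measure[OF prob_space.finite_measure[OF prob_space_chain_law]])
  have "ennreal (measure (?L n) B) = ennreal (measure (?L (n - 1)) (case_nat n -` B)) * ennreal (p n) +
      ennreal (measure (?L (n + 1)) (case_nat n -` B)) * ennreal (1 - p n)"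
    using p by (simp add: emeasure_chain_law_first_step[OF B] walk_kernel_def[of p n] flip: fin)
  also have "\<dots> = ennreal (p n * measure (?L (n - 1)) (case_nat n -` B) +
    (1 - p n) * measure (?L (n + 1)) (case_nat n -` B))"
    using p by (simp add: ennreal_plus ennreal_mult mult.commute)
  finally show ?thesis
    using p by (subst (asm) ennreal_inj) auto
qed

section \<open>Recurrence of nearest-neighbour walks\<close>

locale nearest_neighbour_walk =
  fixes p :: "nat \<Rightarrow> real"
  assumes p: "\<And>n. 0 < p n" "\<And>n. p n < 1"
begin

definition hit :: "nat \<Rightarrow> nat \<Rightarrow> real" where
  "hit x y = measure (chain_law (walk_kernel p) y) {X. \<exists>t. X t = x}"

definition hit_by :: "nat \<Rightarrow> nat \<Rightarrow> nat \<Rightarrow> real" where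
  "hit_by n x y = measure (chain_law (walk_kernel p) y) {X. \<exists>t\<le>n. X t = x}"

definition weight :: "nat \<Rightarrow> real" where
  "weight n = (\<Prod>i<n. p i / (1 - p i))"

lemma weight_pos: "weight n > 0"
  unfolding weight_def using p by (intro prod_pos) simp

lemma weight_Suc: "weight (Suc n) * (1 - p n) = weight n * p n"
  using p[of n] by (simp add: weight_def)

lemma prob_path: "prob_space (chain_law (walk_kernel p) y)"
  by (rule prob_space_chain_law)

lemma measure_path_UNIV: "measure (chain_law (walk_kernel p) y) UNIV = 1"
  using prob_space.prob_space[OF prob_path[of y]] by (simp add: space_chain_law)

lemma hit_events:
  "{X. \<exists>t. X t = x} \<in> sets (PiM UNIV (\<lambda>_::nat. count_space (UNIV :: nat set)))"
  "{X. \<exists>t\<ge>1. X t = x} \<in> sets (PiM UNIV (\<lambda>_::nat. count_space (UNIV :: nat set)))"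
  "{X. \<exists>t\<le>n. X t = x} \<in> sets (PiM UNIV (\<lambda>_::nat. count_space (UNIV :: nat set)))"
proof -
  let ?S = "PiM UNIV (\<lambda>_::nat. count_space (UNIV :: nat set))"
  have "{X \<in> space ?S. \<exists>t. X t = x} \<in> sets ?S" "{X \<in> space ?S. \<exists>t. t \<ge> 1 \<and> X t = x} \<in> sets ?S"
    "{X \<in> space ?S. \<exists>t. t \<le> n \<and> X t = x} \<in> sets ?S"
    by measurable
  then show "{X. \<exists>t. X t = x} \<in> sets ?S" "{X. \<exists>t\<ge>1. X t = x} \<in> sets ?S"
    "{X. \<exists>t\<le>n. X t = x} \<in> sets ?S"
    by (simp_all add: space_PiM)
qed

lemma p_mem: "p n \<in> {0..1}"
  using p[of n] by simp

lemma hit_self: "hit x x = 1"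
proof -
  have "case_nat x -` {X. \<exists>t. X t = x} = UNIV"
    by (auto simp: ex_case_nat)
  then show ?thesis
    unfolding hit_def 
    by (subst measure_walk_first_step[where p = p, OF p_mem hit_events(1)]) (simp add: measure_path_UNIV)
qed

lemma hit_step:
  assumes "y \<noteq> x"
  shows "hit x y = p y * hit x (y - 1) + (1 - p y) * hit x (y + 1)"
proof -
  have "case_nat y -` {X. \<exists>t. X t = x} = {X. \<exists>t. X t = x}"
    using assms by (auto simp: ex_case_nat)
  then show ?thesis
    unfolding hit_def
    by (subst measure_walk_first_step[where p = p, OF p_mem hit_events(1)]) (simp only:)
qed

lemma return_prob:
  "measure (chain_law (walk_kernel p) x) {X. \<exists>t\<ge>1. X t = x} =
     p x * hit x (x - 1) + (1 - p x) * hit x (x + 1)"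
proof -
  have "case_nat x -` {X. \<exists>t\<ge>1. X t = x} = {X. \<exists>t. X t = x}"
    by (auto simp only: vimage_Collect_eq ex_case_nat)
  then show ?thesis
    unfolding hit_def
    by (subst measure_walk_first_step[where p = p, OF p_mem hit_events(2)]) (simp only:)
qed

lemma hit_bounds: "0 \<le> hit x y" "hit x y \<le> 1"
  using prob_space.prob_le_1[OF prob_path] by (simp_all add: hit_def)

lemma hit_by_0: "y \<noteq> x \<Longrightarrow> hit_by 0 x y = 0"
proof -
  assume "y \<noteq> x"
  then have "case_nat y -` {X. \<exists>t\<le>0. X t = x} = {}"
    by auto
  then show ?thesis
    unfolding hit_by_def
    by (subst measure_walk_first_step[where p = p, OF p_mem hit_events(3)]) simp
qed

lemma hit_by_Suc:
  assumes "y \<noteq> x"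
  shows "hit_by (Suc n) x y = p y * hit_by n x (y - 1) + (1 - p y) * hit_by n x (y + 1)"
proof -
  have "case_nat y -` {X. \<exists>t\<le>Suc n. X t = x} = {X. \<exists>t\<le>n. X t = x}"
    using assms by (auto simp: ex_case_nat)
  then show ?thesis
    unfolding hit_by_def
    by (subst measure_walk_first_step[where p = p, OF p_mem hit_events(3)]) (simp only:)
qed

lemma hit_by_le_1: "hit_by n x y \<le> 1"
  using prob_space.prob_le_1[OF prob_path] by (simp add: hit_by_def)

lemma hit_by_tendsto: "(\<lambda>n. hit_by n x y) \<longlonglongrightarrow> hit x y"
proof -
  interpret prob_space "chain_law (walk_kernel p) y" by (rule prob_path)
  have "(\<lambda>n. hit_by n x y) \<longlonglongrightarrow> prob (\<Union>n. {X. \<exists>t\<le>n. X t = x})"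
    unfolding hit_by_def
    by (intro finite_Lim_measure_incseq) (auto simp: sets_chain_law hit_events incseq_def intro: order_trans)
  also have "(\<Union>n::nat. {X. \<exists>t\<le>n. X t = x}) = {X. \<exists>t. X t = x}"
    by blast
  finally show ?thesis by (simp add: hit_def)
qed

lemma hit_le_superharmonic:
  assumes g: "\<And>y. 0 \<le> g y" "1 \<le> g x"
    and super: "\<And>y. y \<noteq> x \<Longrightarrow> p y * g (y - 1) + (1 - p y) * g (y + 1) \<le> g y"
  shows "hit x y \<le> g y"
proof (rule LIMSEQ_le_const2[OF hit_by_tendsto], intro exI allI impI)
  fix n
  show "hit_by n x y \<le> g y"
  proof (induction n arbitrary: y)
    case 0
    show ?case
      using g(1)[of y] g(2) hit_by_0[of y x] hit_by_le_1[of 0 x x] by (cases "y = x") auto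
  next
    case (Suc n)
    show ?case
    proof (cases "y = x")
      case True
      then show ?thesis using g hit_by_le_1[of "Suc n" x x] by simp
    next
      case False
      have "hit_by (Suc n) x y \<le> p y * g (y - 1) + (1 - p y) * g (y + 1)"
        unfolding hit_by_Suc[OF False] using p[of y]
        by (intro add_mono mult_left_mono Suc.IH) auto
      also have "\<dots> \<le> g y" by (rule super[OF False])
      finally show ?thesis .
    qed
  qed
qed

lemma hit_below: "y \<le> x \<Longrightarrow> hit x y = 1"
proof -
  have const: "hit x y = hit x 0" if "y \<le> x" for y
    using that
  proof (induction y rule: less_induct)
    case (less y)
    show ?case
    proof (cases y)
      case (Suc k)
      have "k \<noteq> x" using Suc less.prems by simp
      from hit_step[OF this] have "hit x k = p k * hit x (k - 1) + (1 - p k) * hit x y"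
        by (simp add: Suc)
      moreover have "hit x k = hit x 0" "hit x (k - 1) = hit x 0"
        using less.prems Suc by (auto intro!: less.IH)
      ultimately have "(1 - p k) * (hit x y - hit x 0) = 0"
        by algebra
      then show ?thesis using p[of k] by simp
    qed simp
  qed
  assume "y \<le> x"
  then show "hit x y = 1"
    using const[OF \<open>y \<le> x\<close>] const[OF order_refl] hit_self[of x] by simp
qed

lemma hit_increment:
  "weight (Suc x) * (hit x (Suc x + k) - hit x (x + k)) = weight (Suc x + k) * (hit x (Suc x) - 1)"
proof (induction k)
  case 0
  then show ?case by (simp add: hit_self)
next
  case (Suc k)
  let ?y = "Suc x + k"
  have "hit x ?y = p ?y * hit x (x + k) + (1 - p ?y) * hit x (Suc ?y)"
    using hit_step[of ?y x] by simp
  then have *: "(1 - p ?y) * (hit x (Suc ?y) - hit x ?y) = p ?y * (hit x ?y - hit x (x + k))"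
    by (simp add: algebra_simps)
  have "(1 - p ?y) * (weight (Suc x) * (hit x (Suc ?y) - hit x ?y)) =
      p ?y * (weight (Suc x) * (hit x ?y - hit x (x + k)))"
    using * by algebra
  also have "\<dots> = p ?y * (weight ?y * (hit x (Suc x) - 1))"
    using Suc.IH by simp
  also have "\<dots> = (1 - p ?y) * (weight (Suc ?y) * (hit x (Suc x) - 1))"
    using weight_Suc[of ?y] by algebra
  finally show ?case
    using p[of ?y] by simp
qed

lemma recurrent_walk:
  assumes "\<not> summable weight"
  shows "recurrent_chain (walk_kernel p)"
  unfolding recurrent_chain_def
proof
  fix x
  have "hit x (Suc x) = 1"
  proof (rule ccontr)
    assume neq: "hit x (Suc x) \<noteq> 1"
    define d where "d = 1 - hit x (Suc x)"
    have d: "d > 0" using neq hit_bounds(2)[of x "Suc x"] by (simp add: d_def)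
    have sum: "(\<Sum>k<n. weight (Suc x + k)) * d = weight (Suc x) * (hit x x - hit x (x + n))" for n
    proof (induction n)
      case (Suc n)
      then show ?case using hit_increment[of x n] by (simp add: d_def algebra_simps)
    qed simp
    have "summable (\<lambda>k. weight (k + Suc x))"
    proof (rule summableI_nonneg_bounded)
      fix n
      have "(\<Sum>k<n. weight (Suc x + k)) * d \<le> weight (Suc x) * 1"
        unfolding sum using weight_pos[of "Suc x"] hit_bounds
        by (intro mult_left_mono) (auto simp: hit_self)
      then show "(\<Sum>k<n. weight (k + Suc x)) \<le> weight (Suc x) / d"
        using d by (simp add: field_simps add.commute)
    qed (use weight_pos less_imp_le in auto)
    then show False using assms by (simp only: summable_iff_shift)
  qed
  then have "measure (chain_law (walk_kernel p) x) {X. \<exists>t\<ge>1. X t = x} = 1"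
    unfolding return_prob by (simp add: hit_below)
  then show "measure (chain_law (walk_kernel p) x)
      {X \<in> space (chain_law (walk_kernel p) x). \<exists>t\<ge>1. X t = x} = 1"
    by (simp add: space_chain_law)
qed

lemma transient_walk:
  assumes sum: "summable weight"
  shows "transient_chain (walk_kernel p)"
  unfolding transient_chain_def
proof
  fix x
  define G where "G y = (\<Sum>k. weight (k + Suc y))" for y
  have G_Suc: "G y = weight (Suc y) + G (Suc y)" for y
  proof -
    have "summable (\<lambda>k. weight (k + Suc y))"
      using sum by (rule summable_ignore_initial_segment)
    from suminf_split_head[OF this] show ?thesis by (simp add: G_def)
  qed
  have G_pos: "G y > 0" for y
    unfolding G_def by (intro suminf_pos summable_ignore_initial_segment sum weight_pos)
  define g where "g y = (if y \<le> x then 1 else G y / G x)" for y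
  have G_mono: "G (Suc y) \<le> G y" for y
    using G_Suc[of y] weight_pos[of "Suc y"] by simp
  have "hit x (Suc x) \<le> g (Suc x)"
  proof (rule hit_le_superharmonic)
    fix y assume "y \<noteq> x"
    show "p y * g (y - 1) + (1 - p y) * g (y + 1) \<le> g y"
    proof (cases "y < x")
      case True
      then have "y - 1 \<le> x" by simp
      with True show ?thesis by (simp add: g_def)
    next
      case False
      then obtain k where y: "y = Suc k" "k \<ge> x"
        using \<open>y \<noteq> x\<close> by (cases y) auto
      have "g (y - 1) = G k / G x" "g (y + 1) = G (Suc y) / G x" "g y = G y / G x"
        using y G_pos[of x] by (auto simp: g_def)
      moreover have "p y * G k + (1 - p y) * G (Suc y) = G y"
        using G_Suc[of k] G_Suc[of y] weight_Suc[of y] by (simp add: y algebra_simps)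
      ultimately show ?thesis
        by (simp only: times_divide_eq_right add_divide_distrib[symmetric])
    qed
  qed (use G_pos in \<open>auto simp: g_def less_imp_le\<close>)
  also have "g (Suc x) < 1"
    using G_Suc[of x] weight_pos[of "Suc x"] G_pos[of x] by (simp add: g_def)
  finally have "(1 - p x) * hit x (Suc x) < 1 - p x"
    using p[of x] by simp
  then have "measure (chain_law (walk_kernel p) x) {X. \<exists>t\<ge>1. X t = x} < 1"
    unfolding return_prob by (simp add: hit_below)
  then show "measure (chain_law (walk_kernel p) x)
      {X \<in> space (chain_law (walk_kernel p) x). \<exists>t\<ge>1. X t = x} < 1"
    by (simp add: space_chain_law)
qed

end

section \<open>Probabilistic tools\<close>

lemma (in prob_space) prob_Inter_eq_prod:
  fixes Y :: "nat \<Rightarrow> 'a \<Rightarrow> real"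
  assumes "indep_vars (\<lambda>_. borel) Y UNIV" "finite J" "\<And>n. B n \<in> sets borel"
  shows "prob {\<omega> \<in> space M. \<forall>n\<in>J. Y n \<omega> \<in> B n} = (\<Prod>n\<in>J. prob (Y n -` B n \<inter> space M))"
proof (cases "J = {}")
  case True
  then show ?thesis by (simp add: prob_space)
next
  case False
  have "{\<omega> \<in> space M. \<forall>n\<in>J. Y n \<omega> \<in> B n} = (\<Inter>n\<in>J. Y n -` B n \<inter> space M)"
    using False by auto
  then show ?thesis
    using indep_varsD[OF assms(1) False assms(2) subset_UNIV, of B] assms(3) by simp
qed

lemma (in finite_measure) integrable_bounded:
  fixes f :: "'a \<Rightarrow> real"
  assumes "f \<in> borel_measurable M" "\<And>\<omega>. \<omega> \<in> space M \<Longrightarrow> \<bar>f \<omega>\<bar> \<le> B"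
  shows "integrable M f"
  using assms by (intro integrable_const_bound[where B = B]) (auto intro!: AE_I2)

lemma (in prob_space) char_distr_eq:
  fixes X :: "'a \<Rightarrow> real"
  assumes [measurable]: "X \<in> borel_measurable M"
  shows "char (distr M borel X) t =
    Complex (expectation (\<lambda>\<omega>. cos (t * X \<omega>))) (expectation (\<lambda>\<omega>. sin (t * X \<omega>)))"
proof -
  have int: "integrable M (\<lambda>\<omega>. iexp (t * X \<omega>))"
    by (intro integrable_const_bound[where B = 1]) auto
  have "char (distr M borel X) t = expectation (\<lambda>\<omega>. iexp (t * X \<omega>))"
    by (simp add: char_def integral_distr)
  then show ?thesis
    using integral_Re[OF int] integral_Im[OF int] by (simp add: complex_eq_iff Re_exp Im_exp)
qed

lemma not_summable_exp:
  fixes s :: "nat \<Rightarrow> real"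
  assumes "\<exists>\<^sub>F n in sequentially. s n \<ge> b"
  shows "\<not> summable (\<lambda>n. exp (s n))"
proof
  assume "summable (\<lambda>n. exp (s n))"
  then have "(\<lambda>n. exp (s n)) \<longlonglongrightarrow> 0" by (rule summable_LIMSEQ_zero)
  then have "\<forall>\<^sub>F n in sequentially. exp (s n) < exp b"
    by (rule order_tendstoD) simp
  with assms show False
    unfolding frequently_def by (simp add: not_le)
qed

lemma exp_le_quadratic:
  fixes x :: real
  assumes "\<bar>x\<bar> \<le> 1"
  shows "exp x \<le> 1 + x + x\<^sup>2"
proof (cases "x \<ge> 0")
  case True
  then show ?thesis using assms by (intro exp_bound) auto
next
  case False
  have "1 \<le> (1 - x) * (1 + x + x\<^sup>2)"
  proof -
    have "(1 - x) * (1 + x + x\<^sup>2) = 1 + (- x) * x\<^sup>2" by (simp add: algebra_simps power2_eq_square)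
    moreover have "(- x) * x\<^sup>2 \<ge> 0" using False by (intro mult_nonneg_nonneg) auto
    ultimately show ?thesis by linarith
  qed
  also have "\<dots> \<le> exp (- x) * (1 + x + x\<^sup>2)"
    using exp_ge_add_one_self[of "- x"] assms False
    by (intro mult_right_mono) (auto simp: add_nonneg_nonneg)
  finally show ?thesis
    by (simp add: exp_minus field_simps)
qed

lemma powr_le_increment:
  assumes "0 < \<gamma>" "\<gamma> < 1"
  shows "\<gamma> * real (Suc n) powr (\<gamma> - 1) + real n powr \<gamma> \<le> real (Suc n) powr \<gamma>"
proof (cases "n = 0")
  case True
  then show ?thesis using assms by simp
next
  case False
  let ?x = "real n / real (Suc n)"
  have "?x powr \<gamma> * 1 powr (1 - \<gamma>) \<le> \<gamma> * ?x + (1 - \<gamma>) * 1"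
    using assms False by (intro Youngs_inequality_0) auto
  also have "\<gamma> * ?x + (1 - \<gamma>) * 1 = 1 - \<gamma> / real (Suc n)"
    by (simp add: field_simps)
  finally have "real (Suc n) powr \<gamma> * (?x powr \<gamma>) \<le> real (Suc n) powr \<gamma> * (1 - \<gamma> / real (Suc n))"
    by (intro mult_left_mono) auto
  then show ?thesis
    by (simp add: powr_divide powr_diff algebra_simps)
qed

definition trunc :: "real \<Rightarrow> nat \<Rightarrow> real \<Rightarrow> real" where
  "trunc g n x = (if \<bar>x\<bar> \<le> real n powr g then x else 0)"

lemma measurable_trunc [measurable]: "trunc g n \<in> borel_measurable borel"
  unfolding trunc_def by measurable

lemma trunc_bound: "\<bar>trunc g n x\<bar> \<le> real n powr g"
  by (simp add: trunc_def)

lemma half_le_cos_one: "1 / 2 \<le> cos (1::real)"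
proof -
  have "cos (pi / 3) \<le> cos (1::real)"
    using pi_gt3 by (intro cos_monotone_0_pi_le) auto
  then show ?thesis by (simp add: cos_60)
qed

lemma cos_one_less_one: "cos (1::real) < 1"
  using cos_monotone_0_pi[of 0 1] pi_gt3 by simp

text \<open>Second moment of \<open>\<Sum>k<K. exp (\<i> k u X)\<close> with \<open>u = 1 / (K a)\<close>: where \<open>\<bar>X\<bar> \<le> a\<close>, every term of the
  sum has real part at least \<open>1 / 2\<close>.\<close>

lemma (in prob_space) prob_abs_le_cos:
  fixes X :: "'a \<Rightarrow> real" and K :: nat
  assumes [measurable]: "X \<in> borel_measurable M" and "a > 0" "K > 0" "\<eta> \<ge> 0"
    and cos_le: "\<And>m. 1 \<le> m \<Longrightarrow> m < K \<Longrightarrow> expectation (\<lambda>\<omega>. cos (real m / (real K * a) * X \<omega>)) \<le> \<eta>"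
  shows "prob {\<omega> \<in> space M. \<bar>X \<omega>\<bar> \<le> a} \<le> 4 / K + 4 * \<eta>"
proof -
  define u where "u = 1 / (real K * a)"
  have int: "integrable M (\<lambda>\<omega>. cos (f \<omega>))" if "f \<in> borel_measurable M" for f :: "'a \<Rightarrow> real"
    using that by (intro integrable_const_bound[where B = 1]) auto
  let ?D = "\<lambda>\<omega>. \<Sum>j<K. \<Sum>k<K. cos ((real j - real k) * (u * X \<omega>))"
  have D_eq: "?D \<omega> = (\<Sum>k<K. cos (real k * (u * X \<omega>)))\<^sup>2 + (\<Sum>k<K. sin (real k * (u * X \<omega>)))\<^sup>2" for \<omega>
    by (simp add: power2_eq_square sum_product left_diff_distrib cos_diff sum.distrib)
  have "real K ^ 2 / 4 * prob {\<omega> \<in> space M. \<bar>X \<omega>\<bar> \<le> a} =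
      expectation (\<lambda>\<omega>. real K ^ 2 / 4 * indicator {\<omega> \<in> space M. \<bar>X \<omega>\<bar> \<le> a} \<omega>)"
    by simp
  also have "\<dots> \<le> expectation ?D"
  proof (rule integral_mono_AE')
    show "integrable M ?D"
      by (intro Bochner_Integration.integrable_sum int) measurable
    have "real K ^ 2 / 4 * indicator {\<omega> \<in> space M. \<bar>X \<omega>\<bar> \<le> a} \<omega> \<le> ?D \<omega>" for \<omega>
    proof (cases "\<omega> \<in> space M \<and> \<bar>X \<omega>\<bar> \<le> a")
      case True
      have "1 / 2 \<le> cos (real k * (u * X \<omega>))" if "k < K" for k
      proof -
        have "\<bar>real k * (u * X \<omega>)\<bar> = real k * \<bar>X \<omega>\<bar> / (real K * a)"
          using \<open>a > 0\<close> \<open>K > 0\<close> by (simp add: u_def abs_mult)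
        also have "\<dots> \<le> real K * a / (real K * a)"
          using that True \<open>a > 0\<close> by (intro divide_right_mono mult_mono) auto
        finally have "\<bar>real k * (u * X \<omega>)\<bar> \<le> 1"
          using \<open>a > 0\<close> \<open>K > 0\<close> by simp
        then have "cos 1 \<le> cos \<bar>real k * (u * X \<omega>)\<bar>"
          using pi_gt3 by (intro cos_monotone_0_pi_le) auto
        then show ?thesis using half_le_cos_one by simp
      qed
      then have "(\<Sum>k<K. 1 / 2) \<le> (\<Sum>k<K. cos (real k * (u * X \<omega>)))"
        by (intro sum_mono) auto
      then have "(real K / 2)\<^sup>2 \<le> (\<Sum>k<K. cos (real k * (u * X \<omega>)))\<^sup>2"
        by (intro power_mono) auto
      also have "\<dots> \<le> ?D \<omega>"
        unfolding D_eq by simp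
      finally show ?thesis
        using True by (simp add: power_divide)
    qed (auto simp: D_eq)
    then show "AE \<omega> in M. real K ^ 2 / 4 * indicator {\<omega> \<in> space M. \<bar>X \<omega>\<bar> \<le> a} \<omega> \<le> ?D \<omega>"
      by auto
    show "AE \<omega> in M. 0 \<le> ?D \<omega>"
      unfolding D_eq by auto
  qed
  also have "expectation ?D = (\<Sum>j<K. \<Sum>k<K. expectation (\<lambda>\<omega>. cos ((real j - real k) * (u * X \<omega>))))"
    by (simp add: Bochner_Integration.integral_sum int)
  also have "\<dots> \<le> (\<Sum>j<K. \<Sum>k<K. (if j = k then 1 else 0) + \<eta>)"
  proof (intro sum_mono)
    fix j k assume "j \<in> {..<K}" "k \<in> {..<K}"
    show "expectation (\<lambda>\<omega>. cos ((real j - real k) * (u * X \<omega>))) \<le> (if j = k then 1 else 0) + \<eta>"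
    proof (cases "j = k")
      case True
      then show ?thesis using \<open>\<eta> \<ge> 0\<close> by (simp add: prob_space)
    next
      case False
      define m where "m = (if j < k then k - j else j - k)"
      have m: "1 \<le> m" "m < K"
        using False \<open>j \<in> _\<close> \<open>k \<in> _\<close> by (auto simp: m_def)
      have "cos ((real j - real k) * (u * x)) = cos (real m / (real K * a) * x)" for x
      proof (cases "j < k")
        case True
        then have "real m / (real K * a) * x = - ((real j - real k) * (u * x))"
          by (simp add: m_def u_def of_nat_diff algebra_simps diff_divide_distrib)
        then show ?thesis by (simp only: cos_minus)
      next
        case False
        then show ?thesis by (simp add: m_def u_def of_nat_diff)
      qed
      then show ?thesis using cos_le[OF m] False by simp
    qed
  qed
  also have "\<dots> = real K + real K ^ 2 * \<eta>"
    by (simp add: sum.distrib power2_eq_square distrib_left)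
  finally have "real K ^ 2 / 4 * prob {\<omega> \<in> space M. \<bar>X \<omega>\<bar> \<le> a} \<le> real K ^ 2 / 4 * (4 / K + 4 * \<eta>)"
    using \<open>K > 0\<close> by (simp add: power2_eq_square algebra_simps)
  then show ?thesis
    using \<open>K > 0\<close> by simp
qed

section \<open>Independence in the mixed environment\<close>

context mixed_environment
begin

lemma measurable_chi [measurable]: "chi n \<in> borel_measurable M"
  using chi_indep unfolding indep_vars_def by simp

lemma measurable_xi [measurable]: "xi n \<in> borel_measurable M"
  using xi_indep unfolding indep_vars_def by simp

lemma measurable_zeta [measurable]: "zeta xi n \<in> borel_measurable M"
  unfolding zeta_def by measurable

lemma indep_vars_case_sum: "indep_vars (\<lambda>_. borel) (case_sum chi xi) UNIV"
  unfolding indep_vars_def2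
proof (intro conjI ballI indep_setsI)
  show rv: "case_sum chi xi i \<in> borel_measurable M" for i
    by (cases i) simp_all
  show "{case_sum chi xi i -` A \<inter> space M |A. A \<in> sets borel} \<subseteq> events" for i
    using measurable_sets[OF rv[of i]] by auto
  fix A and J :: "(nat + nat) set"
  assume J: "finite J" and "\<forall>j\<in>J. A j \<in> {case_sum chi xi j -` A \<inter> space M |A. A \<in> sets borel}" "J \<noteq> {}"
  then have "\<forall>j. \<exists>B. B \<in> sets borel \<and> (j \<in> J \<longrightarrow> A j = case_sum chi xi j -` B \<inter> space M)"
    by (auto intro: exI[of _ "{}"])
  then obtain B where B: "\<And>j. B j \<in> sets borel" "\<And>j. j \<in> J \<Longrightarrow> A j = case_sum chi xi j -` B j \<inter> space M"
    by metis
  define J1 J2 where "J1 = Inl -` J" and "J2 = Inr -` J"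
  have fin: "finite J1" "finite J2"
    using J by (auto simp: J1_def J2_def intro!: finite_vimageI)
  have J_eq: "J = Inl ` J1 \<union> Inr ` J2"
  proof (intro equalityI subsetI)
    fix j assume "j \<in> J"
    then show "j \<in> Inl ` J1 \<union> Inr ` J2" by (cases j) (auto simp: J1_def J2_def)
  qed (auto simp: J1_def J2_def)
  let ?C = "\<lambda>f J B. {\<omega> \<in> space M. \<forall>n\<in>J. f n \<omega> \<in> B n}"
  have PiM: "{f. \<forall>n\<in>J. f n \<in> B n} \<in> sets (PiM UNIV (\<lambda>_. borel))"
    if "finite J" "\<And>n. B n \<in> sets borel" for J :: "nat set" and B :: "nat \<Rightarrow> real set"
  proof -
    have "{f \<in> space (PiM UNIV (\<lambda>_. borel)). \<forall>n\<in>J. f n \<in> B n} \<in> sets (PiM UNIV (\<lambda>_. borel))"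
      using that by measurable
    then show ?thesis by (simp add: space_PiM Ball_def)
  qed
  have "(\<Inter>j\<in>J. A j) = {\<omega> \<in> space M. (\<lambda>n. chi n \<omega>) \<in> {f. \<forall>n\<in>J1. f n \<in> B (Inl n)} \<and>
      (\<lambda>n. xi n \<omega>) \<in> {f. \<forall>n\<in>J2. f n \<in> B (Inr n)}}"
  proof -
    have "(\<Inter>j\<in>J. A j) = {\<omega> \<in> space M. \<forall>j\<in>J. case_sum chi xi j \<omega> \<in> B j}"
      using \<open>J \<noteq> {}\<close> B(2) by auto
    also have "\<dots> = {\<omega> \<in> space M. (\<lambda>n. chi n \<omega>) \<in> {f. \<forall>n\<in>J1. f n \<in> B (Inl n)} \<and>
        (\<lambda>n. xi n \<omega>) \<in> {f. \<forall>n\<in>J2. f n \<in> B (Inr n)}}"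
      by (simp add: J_eq ball_Un)
    finally show ?thesis .
  qed
  then have "prob (\<Inter>j\<in>J. A j) = prob (?C chi J1 (\<lambda>n. B (Inl n))) * prob (?C xi J2 (\<lambda>n. B (Inr n)))"
    using indep_varD[OF chi_xi_indep PiM[OF fin(1)] PiM[OF fin(2)], of "\<lambda>n. B (Inl n)" "\<lambda>n. B (Inr n)"] B(1)
    by (simp add: vimage_def Int_def conj_ac)
  also have "\<dots> = (\<Prod>j\<in>Inl ` J1. prob (A j)) * (\<Prod>j\<in>Inr ` J2. prob (A j))"
    using B by (simp add: prob_Inter_eq_prod chi_indep xi_indep fin prod.reindex J_eq)
  also have "\<dots> = (\<Prod>j\<in>J. prob (A j))"
    unfolding J_eq using fin by (intro prod.union_disjoint[symmetric]) auto
  finally show "prob (\<Inter>j\<in>J. A j) = (\<Prod>j\<in>J. prob (A j))" .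
qed

lemma indep_vars_chi_xi:
  assumes [measurable]: "\<And>n. case_prod (f n) \<in> borel_measurable (borel \<Otimes>\<^sub>M borel)"
  shows "indep_vars (\<lambda>_. borel) (\<lambda>n \<omega>. f n (chi n \<omega>) (xi n \<omega>) :: real) UNIV"
proof -
  have "indep_vars (\<lambda>n. PiM {Inl n, Inr n} (\<lambda>_. borel))
      (\<lambda>n \<omega>. restrict (\<lambda>i. case_sum chi xi i \<omega>) {Inl n, Inr n}) UNIV"
    by (rule indep_vars_restrict[OF indep_vars_case_sum]) (auto simp: disjoint_family_on_def)
  from indep_vars_compose2[OF this, of "\<lambda>n g. f n (g (Inl n)) (g (Inr n))" "\<lambda>_. borel"]
  show ?thesis by simp
qed

lemma indep_var_chi_zeta:
  assumes [measurable]: "f \<in> borel_measurable borel" "g \<in> borel_measurable borel"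
  shows "indep_var borel (\<lambda>\<omega>. f (chi n \<omega>) :: real) borel (\<lambda>\<omega>. g (zeta xi n \<omega>) :: real)"
proof -
  from indep_var_compose[OF chi_xi_indep, of "\<lambda>h. f (h n)" borel "\<lambda>h. g (ln (h n / (1 - h n)))" borel]
  show ?thesis by (simp add: comp_def zeta_def)
qed

lemma expectation_zeta:
  assumes [measurable]: "(g :: real \<Rightarrow> real) \<in> borel_measurable borel"
  shows "expectation (\<lambda>\<omega>. g (zeta xi n \<omega>)) = expectation (\<lambda>\<omega>. g (zeta xi 0 \<omega>))"
proof -
  let ?g = "\<lambda>x. g (ln (x / (1 - x)))"
  have "expectation (\<lambda>\<omega>. ?g (xi n \<omega>)) = expectation (\<lambda>\<omega>. ?g (xi 0 \<omega>))"
    using integral_distr[of "xi n" M borel ?g] integral_distr[of "xi 0" M borel ?g] xi_ident[of n] by simp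
  then show ?thesis by (simp add: zeta_def)
qed

lemma prob_zeta:
  assumes [measurable]: "B \<in> sets borel"
  shows "prob {\<omega> \<in> space M. zeta xi n \<omega> \<in> B} = prob {\<omega> \<in> space M. zeta xi 0 \<omega> \<in> B}"
proof -
  have "prob {\<omega> \<in> space M. zeta xi n \<omega> \<in> B} = expectation (\<lambda>\<omega>. indicat_real B (zeta xi n \<omega>))" for n
  proof -
    have "expectation (\<lambda>\<omega>. indicat_real B (zeta xi n \<omega>)) = expectation (indicat_real {\<omega> \<in> space M. zeta xi n \<omega> \<in> B})"
      by (intro Bochner_Integration.integral_cong) (auto split: split_indicator)
    then show ?thesis by simp
  qed
  then show ?thesis using expectation_zeta[of "indicator B" n] assms by simp
qed

lemma expectation_chi: "expectation (chi n) = \<phi> n"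
proof -
  have "expectation (chi n) = expectation (indicat_real {\<omega> \<in> space M. chi n \<omega> = 1})"
    using chi_values[of _ n] by (intro Bochner_Integration.integral_cong) (auto split: split_indicator)
  then show ?thesis by (simp add: chi_prob)
qed

lemma integrable_chi: "integrable M (chi n)"
proof (rule integrable_const_bound[where B = 1])
  show "AE \<omega> in M. norm (chi n \<omega>) \<le> 1"
    using chi_values[of _ n] by (intro AE_I2) fastforce
qed simp

definition log_ratio :: "nat \<Rightarrow> 'a \<Rightarrow> real" where
  "log_ratio n \<omega> = ln ((1 - \<delta>) / (1 + \<delta>)) * chi n \<omega> + (1 - chi n \<omega>) * zeta xi n \<omega>"

lemma env_bounds: "\<omega> \<in> space M \<Longrightarrow> 0 < env \<delta> chi xi \<omega> n" "\<omega> \<in> space M \<Longrightarrow> env \<delta> chi xi \<omega> n < 1"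
  using chi_values[of \<omega> n] xi_values[of \<omega> n] delta by (auto simp: env_def)

lemma exp_log_ratio:
  assumes "\<omega> \<in> space M"
  shows "env \<delta> chi xi \<omega> n / (1 - env \<delta> chi xi \<omega> n) = exp (log_ratio n \<omega>)"
proof -
  consider "chi n \<omega> = 0" | "chi n \<omega> = 1"
    using chi_values[OF assms, of n] by auto
  then show ?thesis
  proof cases
    case 1
    then show ?thesis
      using xi_values[OF assms, of n] by (simp add: env_def log_ratio_def zeta_def)
  next
    case 2
    have "exp (ln ((1 - \<delta>) / (1 + \<delta>))) = (1 - \<delta>) / (1 + \<delta>)"
      using delta by (intro exp_ln) simp
    moreover have "(1 - \<delta>) / 2 / (1 - (1 - \<delta>) / 2) = (1 - \<delta>) / (1 + \<delta>)"
      using delta by (simp add: field_simps)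
    ultimately show ?thesis using 2 by (simp add: env_def log_ratio_def)
  qed
qed

lemma measurable_log_ratio [measurable]: "log_ratio n \<in> borel_measurable M"
  unfolding log_ratio_def by measurable

lemma indep_vars_log_ratio: "indep_vars (\<lambda>_. borel) log_ratio UNIV"
  unfolding log_ratio_def zeta_def
  by (rule indep_vars_chi_xi[of "\<lambda>n x y. ln ((1 - \<delta>) / (1 + \<delta>)) * x + (1 - x) * ln (y / (1 - y))"]) measurable

end

section \<open>Heavy-tailed environments\<close>

locale heavy_tailed_environment = mixed_environment +
  fixes \<alpha> \<beta> c :: real
  assumes symmetric: "\<And>x. x \<ge> 0 \<Longrightarrow>
      prob {\<omega> \<in> space M. zeta xi 0 \<omega> \<le> - x} = prob {\<omega> \<in> space M. zeta xi 0 \<omega> \<ge> x}"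
    and alpha: "1 < \<alpha>" "\<alpha> < 2" and c_pos: "0 < c"
    and tail: "(\<lambda>r. prob {\<omega> \<in> space M. zeta xi 0 \<omega> > r}) \<sim>[at_top] (\<lambda>r. c * r powr (- \<alpha>))"
    and beta: "0 < \<beta>" "\<beta> < 1"
    and phi_eq: "\<And>n. n \<ge> 1 \<Longrightarrow> \<phi> n = real n powr (- \<beta>)"
begin

lemma prob_zeta_less_uminus:
  assumes "x \<ge> 0"
  shows "prob {\<omega> \<in> space M. zeta xi 0 \<omega> < - x} = prob {\<omega> \<in> space M. zeta xi 0 \<omega> > x}"
proof -
  let ?A = "\<lambda>k. {\<omega> \<in> space M. zeta xi 0 \<omega> \<le> - (x + 1 / Suc k)}"
  let ?B = "\<lambda>k. {\<omega> \<in> space M. zeta xi 0 \<omega> \<ge> x + 1 / Suc k}"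
  have dec: "1 / real (Suc n) \<le> 1 / real (Suc m)" if "m \<le> n" for m n
    using that by (simp add: frac_le)
  have arch: "\<exists>k. 1 / real (Suc k) < e" if "e > 0" for e
    using nat_approx_posE[OF that] by metis
  have A: "(\<lambda>k. prob (?A k)) \<longlonglongrightarrow> prob (\<Union>k. ?A k)"
    by (intro finite_Lim_measure_incseq) (auto simp: incseq_def dest!: dec)
  have B: "(\<lambda>k. prob (?B k)) \<longlonglongrightarrow> prob (\<Union>k. ?B k)"
    by (intro finite_Lim_measure_incseq) (auto simp: incseq_def dest!: dec)
  have "prob (?A k) = prob (?B k)" for k
    using assms by (intro symmetric) simp
  with A B have "prob (\<Union>k. ?A k) = prob (\<Union>k. ?B k)"
    by (intro LIMSEQ_unique) simp_all
  moreover have "(\<Union>k. ?A k) = {\<omega> \<in> space M. zeta xi 0 \<omega> < - x}"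
  proof (intro equalityI subsetI)
    fix \<omega> assume \<omega>: "\<omega> \<in> {\<omega> \<in> space M. zeta xi 0 \<omega> < - x}"
    then obtain k where "1 / real (Suc k) < - x - zeta xi 0 \<omega>"
      using arch[of "- x - zeta xi 0 \<omega>"] by auto
    then show "\<omega> \<in> (\<Union>k. ?A k)"
      using \<omega> by (intro UN_I[of k]) auto
  next
    fix \<omega> assume "\<omega> \<in> (\<Union>k. ?A k)"
    then obtain k where "\<omega> \<in> space M" "zeta xi 0 \<omega> \<le> - (x + 1 / real (Suc k))" by blast
    moreover have "1 / real (Suc k) > 0" by simp
    ultimately show "\<omega> \<in> {\<omega> \<in> space M. zeta xi 0 \<omega> < - x}"
      unfolding mem_Collect_eq by linarith
  qed
  moreover have "(\<Union>k. ?B k) = {\<omega> \<in> space M. zeta xi 0 \<omega> > x}"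
  proof (intro equalityI subsetI)
    fix \<omega> assume \<omega>: "\<omega> \<in> {\<omega> \<in> space M. zeta xi 0 \<omega> > x}"
    then obtain k where "1 / real (Suc k) < zeta xi 0 \<omega> - x"
      using arch[of "zeta xi 0 \<omega> - x"] by auto
    then show "\<omega> \<in> (\<Union>k. ?B k)"
      using \<omega> by (intro UN_I[of k]) auto
  next
    fix \<omega> assume "\<omega> \<in> (\<Union>k. ?B k)"
    then obtain k where "\<omega> \<in> space M" "zeta xi 0 \<omega> \<ge> x + 1 / real (Suc k)" by blast
    moreover have "1 / real (Suc k) > 0" by simp
    ultimately show "\<omega> \<in> {\<omega> \<in> space M. zeta xi 0 \<omega> > x}"
      unfolding mem_Collect_eq by linarith
  qed
  ultimately show ?thesis by simp
qed

lemma distr_uminus_zeta: "distr M borel (\<lambda>\<omega>. - zeta xi 0 \<omega>) = distr M borel (zeta xi 0)"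
proof (rule cdf_unique)
  show "cdf (distr M borel (\<lambda>\<omega>. - zeta xi 0 \<omega>)) = cdf (distr M borel (zeta xi 0))"
  proof
    fix x
    have cdf1: "cdf (distr M borel (\<lambda>\<omega>. - zeta xi 0 \<omega>)) x = prob {\<omega> \<in> space M. zeta xi 0 \<omega> \<ge> - x}"
      by (simp add: cdf_def measure_distr vimage_def Int_def minus_le_iff conj_commute)
    have cdf2: "cdf (distr M borel (zeta xi 0)) x = prob {\<omega> \<in> space M. zeta xi 0 \<omega> \<le> x}"
      by (simp add: cdf_def measure_distr vimage_def Int_def conj_commute)
    show "cdf (distr M borel (\<lambda>\<omega>. - zeta xi 0 \<omega>)) x = cdf (distr M borel (zeta xi 0)) x"
    proof (cases "x \<le> 0")
      case True
      then show ?thesis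
        unfolding cdf1 cdf2 using symmetric[of "- x"] by simp
    next
      case False
      have "prob {\<omega> \<in> space M. \<not> zeta xi 0 \<omega> < - x} = 1 - prob {\<omega> \<in> space M. zeta xi 0 \<omega> < - x}"
        by (rule prob_neg) measurable
      moreover have "prob {\<omega> \<in> space M. \<not> zeta xi 0 \<omega> > x} = 1 - prob {\<omega> \<in> space M. zeta xi 0 \<omega> > x}"
        by (rule prob_neg) measurable
      ultimately show ?thesis
        unfolding cdf1 cdf2 using prob_zeta_less_uminus[of x] False by (simp add: not_less)
    qed
  qed
qed (auto simp: real_distribution_distr)

lemma expectation_uminus_zeta:
  assumes [measurable]: "(g :: real \<Rightarrow> real) \<in> borel_measurable borel"
  shows "expectation (\<lambda>\<omega>. g (- zeta xi n \<omega>)) = expectation (\<lambda>\<omega>. g (zeta xi n \<omega>))"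
proof -
  have "expectation (\<lambda>\<omega>. g (- zeta xi 0 \<omega>)) = expectation (\<lambda>\<omega>. g (zeta xi 0 \<omega>))"
    using integral_distr[of "\<lambda>\<omega>. - zeta xi 0 \<omega>" M borel g] integral_distr[of "zeta xi 0" M borel g]
    by (simp add: distr_uminus_zeta)
  moreover have "(\<lambda>x. g (- x)) \<in> borel_measurable borel"
    by measurable
  ultimately show ?thesis
    using expectation_zeta[of g n] expectation_zeta[of "\<lambda>x. g (- x)" n] assms by simp
qed

lemma expectation_odd_zeta:
  assumes "(g :: real \<Rightarrow> real) \<in> borel_measurable borel" "\<And>x. g (- x) = - g x"
  shows "expectation (\<lambda>\<omega>. g (zeta xi n \<omega>)) = 0"
  using expectation_uminus_zeta[OF assms(1), of n] by (simp add: assms(2))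

lemma eventually_tail:
  "\<forall>\<^sub>F r in at_top. 3 / 4 * (c * r powr (- \<alpha>)) \<le> prob {\<omega> \<in> space M. zeta xi 0 \<omega> > r} \<and>
     prob {\<omega> \<in> space M. zeta xi 0 \<omega> > r} \<le> 5 / 4 * (c * r powr (- \<alpha>))"
proof -
  have pos: "\<forall>\<^sub>F r in at_top. c * r powr (- \<alpha>) > 0"
    using eventually_gt_at_top[of 0] by eventually_elim (use c_pos in simp)
  then have "\<forall>\<^sub>F r in at_top. prob {\<omega> \<in> space M. zeta xi 0 \<omega> > r} \<noteq> 0 \<or> c * r powr (- \<alpha>) \<noteq> 0"
    by eventually_elim (rule disjI2, rule less_imp_neq[THEN not_sym])
  from asymp_equivD_strong[OF tail this]
  have lim: "((\<lambda>r. prob {\<omega> \<in> space M. zeta xi 0 \<omega> > r} / (c * r powr (- \<alpha>))) \<longlongrightarrow> 1) at_top" .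
  have "\<forall>\<^sub>F r in at_top. prob {\<omega> \<in> space M. zeta xi 0 \<omega> > r} / (c * r powr (- \<alpha>)) > 3 / 4"
    "\<forall>\<^sub>F r in at_top. prob {\<omega> \<in> space M. zeta xi 0 \<omega> > r} / (c * r powr (- \<alpha>)) < 5 / 4"
    by (rule order_tendstoD(1)[OF lim], simp) (rule order_tendstoD(2)[OF lim], simp)
  with pos show ?thesis
  proof eventually_elim
    case (elim r)
    then show ?case
      unfolding pos_less_divide_eq[OF elim(1)] pos_divide_less_eq[OF elim(1)] by linarith
  qed
qed

lemma prob_annulus_lower:
  "\<forall>\<^sub>F r in at_top. c / 3 * r powr (- \<alpha>) \<le> prob {\<omega> \<in> space M. zeta xi 0 \<omega> \<in> {r<..3 * r}}"
proof -
  have "filterlim (\<lambda>r::real. 3 * r) at_top at_top"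
    by real_asymp
  from eventually_tail[THEN filterlim_iff[THEN iffD1, rule_format, OF this]] eventually_tail eventually_gt_at_top[of 0]
  show ?thesis
  proof eventually_elim
    case (elim r)
    have sub: "{\<omega> \<in> space M. zeta xi 0 \<omega> > 3 * r} \<subseteq> {\<omega> \<in> space M. zeta xi 0 \<omega> > r}"
      using elim by auto
    have "3 powr (- \<alpha>) \<le> (3::real) powr (- 1)"
      using alpha by (intro powr_mono) auto
    then have "(3 * r) powr (- \<alpha>) \<le> 1 / 3 * r powr (- \<alpha>)"
      using elim by (simp add: powr_mult powr_minus)
    then have "5 / 4 * (c * (3 * r) powr (- \<alpha>)) \<le> 5 / 4 * (c * (1 / 3 * r powr (- \<alpha>)))"
      using c_pos by (intro mult_left_mono) auto
    with elim have "c / 3 * r powr (- \<alpha>) \<le>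
        prob {\<omega> \<in> space M. zeta xi 0 \<omega> > r} - prob {\<omega> \<in> space M. zeta xi 0 \<omega> > 3 * r}"
      by (simp add: algebra_simps)
    also have "\<dots> = prob ({\<omega> \<in> space M. zeta xi 0 \<omega> > r} - {\<omega> \<in> space M. zeta xi 0 \<omega> > 3 * r})"
      using sub by (intro finite_measure_Diff[symmetric]) auto
    also have "{\<omega> \<in> space M. zeta xi 0 \<omega> > r} - {\<omega> \<in> space M. zeta xi 0 \<omega> > 3 * r} =
        {\<omega> \<in> space M. zeta xi 0 \<omega> \<in> {r<..3 * r}}"
      by auto
    finally show ?case .
  qed
qed

lemma prob_abs_zeta_upper:
  obtains C where "C > 0" "\<And>n r. r > 0 \<Longrightarrow> prob {\<omega> \<in> space M. \<bar>zeta xi n \<omega>\<bar> > r} \<le> C * r powr (- \<alpha>)"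
proof -
  obtain r0 where r0: "\<And>r. r \<ge> r0 \<Longrightarrow> prob {\<omega> \<in> space M. zeta xi 0 \<omega> > r} \<le> 5 / 4 * (c * r powr (- \<alpha>))"
    using eventually_tail unfolding eventually_at_top_linorder by blast
  define r1 where "r1 = max r0 1"
  define C where "C = max (5 / 2 * c) (r1 powr \<alpha>)"
  have "prob {\<omega> \<in> space M. \<bar>zeta xi n \<omega>\<bar> > r} \<le> C * r powr (- \<alpha>)" if "r > 0" for n r
  proof (cases "r \<ge> r1")
    case True
    have "prob {\<omega> \<in> space M. \<bar>zeta xi n \<omega>\<bar> > r} = prob {\<omega> \<in> space M. \<bar>zeta xi 0 \<omega>\<bar> > r}"
      using prob_zeta[of "{x. \<bar>x\<bar> > r}" n] by simp
    also have "\<dots> \<le> prob ({\<omega> \<in> space M. zeta xi 0 \<omega> < - r} \<union> {\<omega> \<in> space M. zeta xi 0 \<omega> > r})"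
      by (intro finite_measure_mono) auto
    also have "\<dots> \<le> prob {\<omega> \<in> space M. zeta xi 0 \<omega> < - r} + prob {\<omega> \<in> space M. zeta xi 0 \<omega> > r}"
      by (intro measure_Un_le) auto
    also have "\<dots> \<le> 5 / 2 * c * r powr (- \<alpha>)"
      using prob_zeta_less_uminus[of r] that r0[of r] True by (simp add: r1_def)
    also have "\<dots> \<le> C * r powr (- \<alpha>)"
      by (intro mult_right_mono) (auto simp: C_def)
    finally show ?thesis .
  next
    case False
    have "1 = r powr \<alpha> * r powr (- \<alpha>)"
      using that by (simp flip: powr_add)
    also have "\<dots> \<le> C * r powr (- \<alpha>)"
      using False that alpha by (intro mult_right_mono) (auto simp: C_def le_max_iff_disj intro!: powr_mono2)
    finally show ?thesis
      using prob_le_1 order_trans by blast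
  qed
  moreover have "C > 0" using c_pos by (simp add: C_def)
  ultimately show thesis using that by blast
qed

lemma integrable_abs_zeta_powr:
  assumes p: "0 < p" "p < \<alpha>"
  shows "integrable M (\<lambda>\<omega>. \<bar>zeta xi n \<omega>\<bar> powr p)"
proof (rule integrableI_nonneg)
  obtain C where C: "C > 0" "\<And>n r. r > 0 \<Longrightarrow> prob {\<omega> \<in> space M. \<bar>zeta xi n \<omega>\<bar> > r} \<le> C * r powr (- \<alpha>)"
    using prob_abs_zeta_upper by blast
  let ?A = "\<lambda>k. {\<omega> \<in> space M. \<bar>zeta xi n \<omega>\<bar> > 2 ^ k}"
  have pointwise: "ennreal (x powr p) \<le> 1 + (\<Sum>k. ennreal ((2 ^ Suc k) powr p) * indicator {y. y > 2 ^ k} x)"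
    if "x \<ge> 0" for x :: real
  proof (cases "x \<le> 1")
    case True
    then have "x powr p \<le> 1" using p that by (intro powr_le1) auto
    then have "ennreal (x powr p) \<le> 1" by simp
    then show ?thesis by (rule order_trans) simp
  next
    case False
    define k where "k = (LEAST k. x \<le> 2 ^ Suc k)"
    obtain n where "x < 2 ^ n" using real_arch_pow[of 2 x] by auto
    then have ex: "x \<le> 2 ^ Suc n" by (simp add: order.strict_implies_order order.strict_trans2)
    then have k: "x \<le> 2 ^ Suc k" unfolding k_def by (rule LeastI)
    have k': "2 ^ k < x"
    proof (cases k)
      case 0
      then show ?thesis using False by simp
    next
      case (Suc j)
      then have "\<not> x \<le> 2 ^ Suc j" using not_less_Least[of j "\<lambda>k. x \<le> 2 ^ Suc k"] by (simp add: k_def)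
      then show ?thesis using Suc by simp
    qed
    have "ennreal (x powr p) \<le> ennreal ((2 ^ Suc k) powr p) * indicator {y. y > 2 ^ k} x"
      using k k' that p by (auto intro!: ennreal_leI powr_mono2)
    also have "\<dots> = (\<Sum>i\<in>{k}. ennreal ((2 ^ Suc i) powr p) * indicator {y. y > 2 ^ i} x)"
      by (simp only: sum.insert sum.empty finite.emptyI empty_iff not_False_eq_True add_0_right)
    also have "\<dots> \<le> (\<Sum>k. ennreal ((2 ^ Suc k) powr p) * indicator {y. y > 2 ^ k} x)"
      by (rule sum_le_suminf) auto
    also have "\<dots> \<le> 1 + \<dots>" by simp
    finally show ?thesis .
  qed
  have term_bound: "ennreal ((2 ^ Suc k) powr p) * emeasure M (?A k) \<le> ennreal (2 powr p * C * (2 powr (p - \<alpha>)) ^ k)" for k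
  proof -
    have "(2 ^ Suc k) powr p * prob (?A k) \<le> (2 ^ Suc k) powr p * (C * (2 ^ k) powr (- \<alpha>))"
      by (intro mult_left_mono C) auto
    also have "\<dots> = 2 powr p * C * (2 powr (p - \<alpha>)) ^ k"
    proof -
      have pow: "((2::real) ^ k) powr q = (2 powr q) ^ k" for q
        by (simp add: powr_powr mult.commute flip: powr_realpow)
      have "(2 powr (p - \<alpha>)) ^ k = (2 powr p) ^ k * (2 powr (- \<alpha>)) ^ k"
        by (simp flip: power_mult_distrib powr_add)
      moreover have "((2::real) ^ Suc k) powr p = 2 powr p * (2 powr p) ^ k"
        by (simp add: powr_mult pow)
      ultimately show ?thesis
        by (simp add: pow)
    qed
    finally show ?thesis
      by (simp add: emeasure_eq_measure ennreal_leI flip: ennreal_mult)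
  qed
  have "(\<integral>\<^sup>+\<omega>. ennreal (\<bar>zeta xi n \<omega>\<bar> powr p) \<partial>M) \<le>
      (\<integral>\<^sup>+\<omega>. 1 + (\<Sum>k. ennreal ((2 ^ Suc k) powr p) * indicator (?A k) \<omega>) \<partial>M)"
  proof (rule nn_integral_mono)
    fix \<omega> assume "\<omega> \<in> space M"
    then have "indicator (?A k) \<omega> = (indicator {y. y > 2 ^ k} \<bar>zeta xi n \<omega>\<bar> :: ennreal)" for k
      by (simp split: split_indicator)
    then show "ennreal (\<bar>zeta xi n \<omega>\<bar> powr p) \<le> 1 + (\<Sum>k. ennreal ((2 ^ Suc k) powr p) * indicator (?A k) \<omega>)"
      using pointwise[of "\<bar>zeta xi n \<omega>\<bar>"] by simp
  qed
  also have "\<dots> = 1 + (\<Sum>k. ennreal ((2 ^ Suc k) powr p) * emeasure M (?A k))"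
    by (simp add: nn_integral_add nn_integral_suminf nn_integral_cmult_indicator emeasure_space_1)
  also have "\<dots> \<le> 1 + (\<Sum>k. ennreal (2 powr p * C * (2 powr (p - \<alpha>)) ^ k))"
    by (intro add_left_mono suminf_le term_bound) auto
  also have "\<dots> = 1 + ennreal (\<Sum>k. 2 powr p * C * (2 powr (p - \<alpha>)) ^ k)"
  proof -
    have "2 powr (p - \<alpha>) < 2 powr (0::real)"
      using p by (intro powr_less_mono) auto
    then have "summable (\<lambda>k. 2 powr p * C * (2 powr (p - \<alpha>)) ^ k)"
      by (intro summable_mult summable_geometric) simp
    then show ?thesis using C(1) by (subst suminf_ennreal2) auto
  qed
  also have "\<dots> < \<infinity>" by simp
  finally show "(\<integral>\<^sup>+\<omega>. ennreal (\<bar>zeta xi n \<omega>\<bar> powr p) \<partial>M) < \<infinity>" .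
qed auto

section \<open>Dominating drift\<close>

lemma sum_phi_upper: "(\<Sum>i<n. \<phi> i) \<le> 1 + real n powr (1 - \<beta>) / (1 - \<beta>)"
proof (cases n)
  case (Suc m)
  have "(1 - \<beta>) * (\<Sum>i<m. \<phi> (Suc i)) \<le> real m powr (1 - \<beta>)" for m
  proof (induction m)
    case (Suc m)
    then show ?case
      using powr_le_increment[of "1 - \<beta>" m] beta phi_eq[of "Suc m"] by (simp add: algebra_simps)
  qed simp
  then have "(\<Sum>i<m. \<phi> (Suc i)) \<le> real m powr (1 - \<beta>) / (1 - \<beta>)"
    using beta by (simp add: field_simps)
  also have "\<dots> \<le> real n powr (1 - \<beta>) / (1 - \<beta>)"
    using beta by (intro divide_right_mono powr_mono2) (auto simp: Suc)
  finally show ?thesis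
    using phi[of 0] unfolding Suc sum.lessThan_Suc_shift by simp
qed simp

lemma sum_phi_lower:
  assumes "n \<ge> 2"
  shows "(\<Sum>i<n. \<phi> i) \<ge> real n powr (1 - \<beta>) / 2"
proof -
  have "real n / 2 * real n powr (- \<beta>) \<le> real (n - 1) * real n powr (- \<beta>)"
    using assms by (intro mult_right_mono) auto
  also have "\<dots> = (\<Sum>i\<in>{1..<n}. real n powr (- \<beta>))"
    by simp
  also have "\<dots> \<le> (\<Sum>i\<in>{1..<n}. \<phi> i)"
    using beta by (intro sum_mono) (auto simp: phi_eq intro!: powr_mono2')
  also have "\<dots> \<le> (\<Sum>i<n. \<phi> i)"
    using phi by (intro sum_mono2) auto
  finally show ?thesis
    using assms by (simp add: powr_diff powr_minus field_simps)
qed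

definition trunc_ratio :: "real \<Rightarrow> nat \<Rightarrow> 'a \<Rightarrow> real" where
  "trunc_ratio g n \<omega> = ln ((1 - \<delta>) / (1 + \<delta>)) * chi n \<omega> + (1 - chi n \<omega>) * trunc g n (zeta xi n \<omega>)"

lemma measurable_trunc_ratio [measurable]: "trunc_ratio g n \<in> borel_measurable M"
  unfolding trunc_ratio_def by measurable

lemma indep_vars_trunc_ratio: "indep_vars (\<lambda>_. borel) (trunc_ratio g) UNIV"
  unfolding trunc_ratio_def zeta_def
  by (rule indep_vars_chi_xi[of "\<lambda>n x y. ln ((1 - \<delta>) / (1 + \<delta>)) * x + (1 - x) * trunc g n (ln (y / (1 - y)))"])
    measurable

lemma trunc_ratio_bound:
  assumes "\<omega> \<in> space M"
  shows "\<bar>trunc_ratio g n \<omega>\<bar> \<le> max \<bar>ln ((1 - \<delta>) / (1 + \<delta>))\<bar> (real n powr g)"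
  using chi_values[OF assms, of n] trunc_bound[of g n "zeta xi n \<omega>"]
  by (auto simp: trunc_ratio_def le_max_iff_disj)

lemma expectation_trunc_ratio:
  "expectation (trunc_ratio g n) = ln ((1 - \<delta>) / (1 + \<delta>)) * \<phi> n"
proof -
  have int: "integrable M (\<lambda>\<omega>. trunc g n (zeta xi n \<omega>))" "integrable M (\<lambda>\<omega>. 1 - chi n \<omega>)"
    using integrable_chi by (auto intro: integrable_bounded[OF _ trunc_bound])
  have indep: "indep_var borel (\<lambda>\<omega>. 1 - chi n \<omega>) borel (\<lambda>\<omega>. trunc g n (zeta xi n \<omega>))"
    by (rule indep_var_chi_zeta[of "\<lambda>x. 1 - x"]) auto
  have "expectation (trunc_ratio g n) = ln ((1 - \<delta>) / (1 + \<delta>)) * \<phi> n +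
      expectation (\<lambda>\<omega>. 1 - chi n \<omega>) * expectation (\<lambda>\<omega>. trunc g n (zeta xi n \<omega>))"
    unfolding trunc_ratio_def using indep_var_integrable[OF indep int(2,1)] integrable_chi
    by (simp add: indep_var_lebesgue_integral[OF indep int(2,1)] expectation_chi)
  also have "expectation (\<lambda>\<omega>. trunc g n (zeta xi n \<omega>)) = 0"
    by (rule expectation_odd_zeta) (auto simp: trunc_def)
  finally show ?thesis by simp
qed

definition abs_moment :: "real \<Rightarrow> real" where
  "abs_moment p = expectation (\<lambda>\<omega>. \<bar>zeta xi 0 \<omega>\<bar> powr p)"

lemma abs_moment_nonneg: "abs_moment p \<ge> 0"
  unfolding abs_moment_def by simp

lemma second_moment_trunc_ratio:
  assumes p: "0 < p" "p < \<alpha>"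
  shows "expectation (\<lambda>\<omega>. (trunc_ratio g n \<omega>)\<^sup>2) \<le>
    (ln ((1 - \<delta>) / (1 + \<delta>)))\<^sup>2 + real n powr (g * (2 - p)) * abs_moment p"
proof -
  let ?l = "ln ((1 - \<delta>) / (1 + \<delta>))"
  have bound: "(trunc_ratio g n \<omega>)\<^sup>2 \<le> ?l\<^sup>2 + real n powr (g * (2 - p)) * \<bar>zeta xi n \<omega>\<bar> powr p"
    if \<omega>: "\<omega> \<in> space M" for \<omega>
  proof -
    consider "chi n \<omega> = 1" | "chi n \<omega> = 0" "\<bar>zeta xi n \<omega>\<bar> \<le> real n powr g" "zeta xi n \<omega> \<noteq> 0"
      | "trunc_ratio g n \<omega> = 0"
      using chi_values[OF \<omega>, of n] by 
        (cases "zeta xi n \<omega> = 0"; cases "\<bar>zeta xi n \<omega>\<bar> \<le> real n powr g"; auto simp: trunc_ratio_def trunc_def)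
    then show ?thesis
    proof cases
      case 2
      have "(zeta xi n \<omega>)\<^sup>2 = \<bar>zeta xi n \<omega>\<bar> powr (2 - p) * \<bar>zeta xi n \<omega>\<bar> powr p"
        using 2 by (simp add: powr_numeral flip: powr_add)
      also have "\<dots> \<le> (real n powr g) powr (2 - p) * \<bar>zeta xi n \<omega>\<bar> powr p"
        using 2 p alpha by (intro mult_right_mono powr_mono2) auto
      finally show ?thesis
        using 2 by (simp add: trunc_ratio_def trunc_def powr_powr add_increasing)
    qed (auto simp: trunc_ratio_def)
  qed
  have int: "integrable M (\<lambda>\<omega>. ?l\<^sup>2 + real n powr (g * (2 - p)) * \<bar>zeta xi n \<omega>\<bar> powr p)"
    using integrable_abs_zeta_powr[OF p] by simp
  have "expectation (\<lambda>\<omega>. (trunc_ratio g n \<omega>)\<^sup>2) \<le>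
      expectation (\<lambda>\<omega>. ?l\<^sup>2 + real n powr (g * (2 - p)) * \<bar>zeta xi n \<omega>\<bar> powr p)"
    by (intro integral_mono_AE' int AE_I2 bound) auto
  also have "\<dots> = ?l\<^sup>2 + real n powr (g * (2 - p)) * abs_moment p"
    using integrable_abs_zeta_powr[OF p] expectation_zeta[of "\<lambda>x. \<bar>x\<bar> powr p" n]
    by (simp add: abs_moment_def prob_space)
  finally show ?thesis .
qed

lemma exp_moment_trunc_ratio:
  assumes p: "0 < p" "p < \<alpha>" and s: "\<bar>s\<bar> * \<bar>ln ((1 - \<delta>) / (1 + \<delta>))\<bar> \<le> 1" "\<bar>s\<bar> * real n powr g \<le> 1"
  shows "expectation (\<lambda>\<omega>. exp (s * trunc_ratio g n \<omega>)) \<le>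
    exp (s * ln ((1 - \<delta>) / (1 + \<delta>)) * \<phi> n +
      s\<^sup>2 * ((ln ((1 - \<delta>) / (1 + \<delta>)))\<^sup>2 + real n powr (g * (2 - p)) * abs_moment p))"
proof -
  let ?l = "ln ((1 - \<delta>) / (1 + \<delta>))" and ?B = "max \<bar>ln ((1 - \<delta>) / (1 + \<delta>))\<bar> (real n powr g)"
  have sV: "\<bar>s * trunc_ratio g n \<omega>\<bar> \<le> 1" if "\<omega> \<in> space M" for \<omega>
  proof -
    have "\<bar>s * trunc_ratio g n \<omega>\<bar> \<le> \<bar>s\<bar> * ?B"
      unfolding abs_mult by (intro mult_left_mono trunc_ratio_bound that) simp
    also have "\<dots> \<le> 1"
      using s by (cases "\<bar>?l\<bar> \<le> real n powr g") (auto simp: max_def)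
    finally show ?thesis .
  qed
  have int: "integrable M (trunc_ratio g n)"
    by (rule integrable_bounded[OF _ trunc_ratio_bound]) auto
  have int2: "integrable M (\<lambda>\<omega>. (trunc_ratio g n \<omega>)\<^sup>2)"
    by (rule integrable_bounded[where B = "?B\<^sup>2"]) (auto intro!: power2_le_iff_abs_le[THEN iffD2] trunc_ratio_bound)
  have "expectation (\<lambda>\<omega>. exp (s * trunc_ratio g n \<omega>)) \<le>
      expectation (\<lambda>\<omega>. 1 + s * trunc_ratio g n \<omega> + s\<^sup>2 * (trunc_ratio g n \<omega>)\<^sup>2)"
  proof (rule integral_mono_AE')
    show le: "AE \<omega> in M. exp (s * trunc_ratio g n \<omega>) \<le> 1 + s * trunc_ratio g n \<omega> + s\<^sup>2 * (trunc_ratio g n \<omega>)\<^sup>2"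
      using exp_le_quadratic[OF sV] by (auto simp: power_mult_distrib)
    from le show "AE \<omega> in M. 0 \<le> 1 + s * trunc_ratio g n \<omega> + s\<^sup>2 * (trunc_ratio g n \<omega>)\<^sup>2"
      by eventually_elim (rule order_trans[OF exp_ge_zero])
  qed (use int int2 in auto)
  also have "\<dots> = 1 + s * (?l * \<phi> n) + s\<^sup>2 * expectation (\<lambda>\<omega>. (trunc_ratio g n \<omega>)\<^sup>2)"
    using int int2 by (simp add: expectation_trunc_ratio prob_space)
  also have "\<dots> \<le> 1 + s * (?l * \<phi> n) + s\<^sup>2 * (?l\<^sup>2 + real n powr (g * (2 - p)) * abs_moment p)"
    by (intro add_left_mono mult_left_mono second_moment_trunc_ratio p) auto
  also have "\<dots> \<le> exp (s * ?l * \<phi> n + s\<^sup>2 * (?l\<^sup>2 + real n powr (g * (2 - p)) * abs_moment p))"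
    using exp_ge_add_one_self[of "s * ?l * \<phi> n + s\<^sup>2 * (?l\<^sup>2 + real n powr (g * (2 - p)) * abs_moment p)"]
    by (simp add: algebra_simps)
  finally show ?thesis .
qed

text \<open>Chernoff bound with parameter \<open>s = \<sigma> n powr - g\<close>, which keeps \<open>s\<close> times a truncated increment
  in \<open>[-1, 1]\<close>.\<close>

lemma prob_trunc_sum:
  assumes p: "0 < p" "p < \<alpha>" "1 < g * p" and g: "0 < g"
    and \<sigma>: "\<bar>\<sigma>\<bar> = 1" "\<sigma> * ln ((1 - \<delta>) / (1 + \<delta>)) < 0"
    and n: "n \<ge> 2" "real n powr g \<ge> \<bar>ln ((1 - \<delta>) / (1 + \<delta>))\<bar>"
  shows "prob {\<omega> \<in> space M. \<sigma> * (\<Sum>i<n. trunc_ratio g i \<omega>) \<ge> - (real n powr g)} \<le>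
    exp (1 + (ln ((1 - \<delta>) / (1 + \<delta>)))\<^sup>2 + abs_moment p) *
    exp (- (\<bar>ln ((1 - \<delta>) / (1 + \<delta>))\<bar> / 2 * real n powr (1 - \<beta> - g)))"
proof -
  let ?l = "ln ((1 - \<delta>) / (1 + \<delta>))"
  define s where "s = \<sigma> * real n powr (- g)"
  have n0: "real n > 0" using n by simp
  have abs_s: "\<bar>s\<bar> = real n powr (- g)"
    using \<sigma> by (simp add: s_def abs_mult)
  have s2: "s\<^sup>2 = real n powr (- 2 * g)"
  proof -
    have "s\<^sup>2 = (real n powr (- g))\<^sup>2" using abs_s by (simp flip: power2_abs[of s])
    also have "\<dots> = real n powr (- 2 * g)" by (simp add: power2_eq_square flip: powr_add)
    finally show ?thesis .
  qed
  let ?E = "\<lambda>i. s * ?l * \<phi> i + s\<^sup>2 * (?l\<^sup>2 + real n powr (g * (2 - p)) * abs_moment p)"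
  let ?X = "\<lambda>i \<omega>. exp (s * trunc_ratio g i \<omega>)"
  have X_bound: "\<bar>?X i \<omega>\<bar> \<le> exp (\<bar>s\<bar> * max \<bar>?l\<bar> (real i powr g))" if "\<omega> \<in> space M" for i \<omega>
  proof -
    have "s * trunc_ratio g i \<omega> \<le> \<bar>s\<bar> * \<bar>trunc_ratio g i \<omega>\<bar>"
      by (simp flip: abs_mult)
    also have "\<dots> \<le> \<bar>s\<bar> * max \<bar>?l\<bar> (real i powr g)"
      by (intro mult_left_mono trunc_ratio_bound that) simp
    finally show ?thesis by simp
  qed
  have int: "integrable M (?X i)" for i
    by (rule integrable_bounded[OF _ X_bound]) auto
  have indep: "indep_vars (\<lambda>_. borel) ?X {..<n}"
    using indep_vars_compose2[OF indep_vars_subset[OF indep_vars_trunc_ratio[of g] subset_UNIV[of "{..<n}"]],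
        of "\<lambda>_ x. exp (s * x)" "\<lambda>_. borel"]
    by simp
  have EX: "expectation (?X i) \<le> exp (?E i)" if "i < n" for i
  proof -
    have i: "real i powr q \<le> real n powr q" if "q > 0" for q
      using that \<open>i < n\<close> by (intro powr_mono2) auto
    have "\<bar>s\<bar> * real i powr g \<le> real n powr (- g) * real n powr g"
      unfolding abs_s by (intro mult_left_mono i g) auto
    also have "\<dots> = 1" using n0 by (simp flip: powr_add)
    finally have s1: "\<bar>s\<bar> * real i powr g \<le> 1" .
    have "\<bar>s\<bar> * \<bar>?l\<bar> \<le> real n powr (- g) * real n powr g"
      unfolding abs_s by (intro mult_left_mono n) auto
    also have "\<dots> = 1" using n0 by (simp flip: powr_add)
    finally have "\<bar>s\<bar> * \<bar>?l\<bar> \<le> 1" .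
    from exp_moment_trunc_ratio[OF p(1,2) this s1]
    have "expectation (?X i) \<le> exp (s * ?l * \<phi> i + s\<^sup>2 * (?l\<^sup>2 + real i powr (g * (2 - p)) * abs_moment p))" .
    also have "\<dots> \<le> exp (?E i)"
      using p alpha g
      by (intro exp_le_cancel_iff[THEN iffD2] add_left_mono mult_left_mono mult_right_mono i abs_moment_nonneg) auto
    finally show ?thesis .
  qed
  have "{\<omega> \<in> space M. \<sigma> * (\<Sum>i<n. trunc_ratio g i \<omega>) \<ge> - (real n powr g)} =
      {\<omega> \<in> space M. (\<Prod>i<n. ?X i \<omega>) \<ge> exp (- 1)}"
  proof (intro Collect_cong conj_cong refl)
    fix \<omega>
    have "(\<Prod>i<n. ?X i \<omega>) = exp (s * (\<Sum>i<n. trunc_ratio g i \<omega>))"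
      by (simp add: exp_sum sum_distrib_left)
    then have "(\<Prod>i<n. ?X i \<omega>) \<ge> exp (- 1) \<longleftrightarrow> - 1 \<le> s * (\<Sum>i<n. trunc_ratio g i \<omega>)"
      by simp
    also have "\<dots> \<longleftrightarrow> - (real n powr g) \<le> \<sigma> * (\<Sum>i<n. trunc_ratio g i \<omega>)"
      using n0 by (simp add: s_def powr_minus field_simps)
    finally show "- (real n powr g) \<le> \<sigma> * (\<Sum>i<n. trunc_ratio g i \<omega>) \<longleftrightarrow> (\<Prod>i<n. ?X i \<omega>) \<ge> exp (- 1)"
      by simp
  qed
  also have "prob \<dots> \<le> expectation (\<lambda>\<omega>. \<Prod>i<n. ?X i \<omega>) / exp (- 1)"
    by (rule integral_Markov_inequality_measure[where A = "space M"])
      (auto intro!: indep_vars_integrable indep int prod_nonneg)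
  also have "expectation (\<lambda>\<omega>. \<Prod>i<n. ?X i \<omega>) = (\<Prod>i<n. expectation (?X i))"
    by (intro indep_vars_lebesgue_integral indep int) auto
  also have "\<dots> \<le> (\<Prod>i<n. exp (?E i))"
    using EX by (intro prod_mono) auto
  also have "\<dots> = exp (s * ?l * (\<Sum>i<n. \<phi> i) + real n * (s\<^sup>2 * (?l\<^sup>2 + real n powr (g * (2 - p)) * abs_moment p)))"
    by (simp add: exp_sum[symmetric] sum.distrib sum_distrib_left)
  also have "\<dots> \<le> exp (- (\<bar>?l\<bar> / 2 * real n powr (1 - \<beta> - g)) + (?l\<^sup>2 + abs_moment p))"
  proof (intro exp_le_cancel_iff[THEN iffD2] add_mono)
    have "s * ?l = - (\<bar>?l\<bar> * real n powr (- g))"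
    proof -
      have "\<sigma> = 1 \<or> \<sigma> = - 1" using \<sigma>(1) by linarith
      then show ?thesis using \<sigma>(2) by (auto simp: s_def)
    qed
    moreover have "\<bar>?l\<bar> * real n powr (- g) * (real n powr (1 - \<beta>) / 2) \<le> \<bar>?l\<bar> * real n powr (- g) * (\<Sum>i<n. \<phi> i)"
      using sum_phi_lower[OF n(1)] by (intro mult_left_mono) auto
    moreover have "real n powr (- g) * real n powr (1 - \<beta>) = real n powr (1 - \<beta> - g)"
      by (simp flip: powr_add)
    ultimately show "s * ?l * (\<Sum>i<n. \<phi> i) \<le> - (\<bar>?l\<bar> / 2 * real n powr (1 - \<beta> - g))"
      by (simp flip: mult.assoc) (simp add: mult.assoc)
    have "g * p < g * 2" using p alpha g by simp
    then have g2: "1 < 2 * g" using p(3) by simp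
    have le1: "real n powr q \<le> 1" if "q \<le> 0" for q
      using that n powr_mono[of q 0 "real n"] by simp
    have "real n * (s\<^sup>2 * (?l\<^sup>2 + real n powr (g * (2 - p)) * abs_moment p)) =
        real n powr (1 - 2 * g) * ?l\<^sup>2 + real n powr (1 - g * p) * abs_moment p"
    proof -
      have "real n * s\<^sup>2 = real n powr (1 - 2 * g)"
        using n0 by (simp add: s2 powr_diff powr_minus divide_inverse)
      moreover have "real n powr (1 - 2 * g) * real n powr (g * (2 - p)) = real n powr (1 - g * p)"
        by (simp add: algebra_simps flip: powr_add)
      ultimately show ?thesis by (simp add: distrib_left flip: mult.assoc)
    qed
    also have "\<dots> \<le> 1 * ?l\<^sup>2 + 1 * abs_moment p"
      using g2 p by (intro add_mono mult_right_mono le1 abs_moment_nonneg) auto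
    finally show "real n * (s\<^sup>2 * (?l\<^sup>2 + real n powr (g * (2 - p)) * abs_moment p)) \<le> ?l\<^sup>2 + abs_moment p"
      by simp
  qed
  finally have "prob {\<omega> \<in> space M. \<sigma> * (\<Sum>i<n. trunc_ratio g i \<omega>) \<ge> - (real n powr g)} \<le>
    exp (- (\<bar>?l\<bar> / 2 * real n powr (1 - \<beta> - g)) + (?l\<^sup>2 + abs_moment p)) / exp (- 1)"
    by (simp add: divide_right_mono)
  then show ?thesis
    by (simp flip: exp_add exp_diff add: algebra_simps)
qed

lemma AE_drift_dominates:
  assumes \<beta>: "\<beta> < 1 - 1 / \<alpha>"
    and \<sigma>: "\<bar>\<sigma>\<bar> = 1" "\<sigma> * ln ((1 - \<delta>) / (1 + \<delta>)) < 0"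
  obtains g where "g > 0"
    "AE \<omega> in M. \<exists>B. \<forall>\<^sub>F n in sequentially. \<sigma> * (\<Sum>i<n. log_ratio i \<omega>) \<le> B - real n powr g"
proof -
  let ?l = "ln ((1 - \<delta>) / (1 + \<delta>))"
  obtain g where g: "1 / \<alpha> < g" "g < 1 - \<beta>"
    using \<beta> dense[of "1 / \<alpha>" "1 - \<beta>"] by auto
  have g0: "g > 0" using g(1) alpha by (smt (verit) divide_pos_pos)
  have "1 / g < \<alpha>" using g(1) g0 alpha by (simp add: field_simps)
  then obtain p where p: "1 / g < p" "p < \<alpha>" using dense by blast
  have p0: "p > 0" using p(1) g0 by (smt (verit) divide_pos_pos)
  have gp: "1 < g * p" using p(1) g0 by (simp add: field_simps)
  have g\<alpha>: "1 < g * \<alpha>" using gp p(2) g0 by (smt (verit) mult_strict_left_mono)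
  obtain C where C: "C > 0" "\<And>n r. r > 0 \<Longrightarrow> prob {\<omega> \<in> space M. \<bar>zeta xi n \<omega>\<bar> > r} \<le> C * r powr (- \<alpha>)"
    using prob_abs_zeta_upper by blast
  have "AE \<omega> in M. \<forall>\<^sub>F n in sequentially.
      \<omega> \<in> space M - {\<omega> \<in> space M. \<bar>zeta xi n \<omega>\<bar> > real n powr g}"
  proof (rule borel_cantelli_AE1)
    show "summable (\<lambda>n. prob {\<omega> \<in> space M. \<bar>zeta xi n \<omega>\<bar> > real n powr g})"
    proof (rule summable_comparison_test_ev)
      show "\<forall>\<^sub>F n in sequentially.
          norm (prob {\<omega> \<in> space M. \<bar>zeta xi n \<omega>\<bar> > real n powr g}) \<le> C * real n powr (- (g * \<alpha>))"
        using eventually_gt_at_top[of 0]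
      proof eventually_elim
        case (elim n)
        then show ?case using C(2)[of "real n powr g" n] by (simp add: powr_powr)
      qed
      show "summable (\<lambda>n. C * real n powr (- (g * \<alpha>)))"
        using g\<alpha> by (intro summable_mult) (simp add: summable_real_powr_iff)
    qed
  qed (auto simp: emeasure_eq_measure)
  moreover have "AE \<omega> in M. \<forall>\<^sub>F n in sequentially.
      \<omega> \<in> space M - {\<omega> \<in> space M. \<sigma> * (\<Sum>i<n. trunc_ratio g i \<omega>) \<ge> - (real n powr g)}"
  proof (rule borel_cantelli_AE1)
    show "summable (\<lambda>n. prob {\<omega> \<in> space M. \<sigma> * (\<Sum>i<n. trunc_ratio g i \<omega>) \<ge> - (real n powr g)})"
    proof (rule summable_comparison_test_ev)
      let ?b = "\<lambda>n. exp (1 + ?l\<^sup>2 + abs_moment p) * exp (- (\<bar>?l\<bar> / 2 * real n powr (1 - \<beta> - g)))"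
      have "filterlim (\<lambda>n. real n powr g) at_top sequentially"
        using g0 by real_asymp
      then have "\<forall>\<^sub>F n in sequentially. real n powr g \<ge> \<bar>?l\<bar>"
        by (simp add: filterlim_at_top)
      then show "\<forall>\<^sub>F n in sequentially.
          norm (prob {\<omega> \<in> space M. \<sigma> * (\<Sum>i<n. trunc_ratio g i \<omega>) \<ge> - (real n powr g)}) \<le> ?b n"
        using eventually_ge_at_top[of 2]
      proof eventually_elim
        case (elim n)
        then show ?case using prob_trunc_sum[OF p0 p(2) gp g0 \<sigma> elim(2,1)] by simp
      qed
      show "summable ?b"
      proof (intro summable_mult, rule summable_comparison_test_bigo)
        show "summable (\<lambda>n. norm (real n powr (- 2)))"
          by (simp add: summable_real_powr_iff)
        define k d where "k = \<bar>?l\<bar> / 2" and "d = 1 - \<beta> - g"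
        have "k > 0" "d > 0" using \<sigma>(2) g(2) by (auto simp: k_def d_def)
        then have "(\<lambda>n. exp (- (k * real n powr d))) \<in> O(\<lambda>n. real n powr (- 2))"
          by real_asymp
        then show "(\<lambda>n. exp (- (\<bar>?l\<bar> / 2 * real n powr (1 - \<beta> - g)))) \<in> O(\<lambda>n. real n powr (- 2))"
          by (simp add: k_def d_def)
      qed
    qed
  qed (auto simp: emeasure_eq_measure)
  ultimately have "AE \<omega> in M. \<exists>B. \<forall>\<^sub>F n in sequentially. \<sigma> * (\<Sum>i<n. log_ratio i \<omega>) \<le> B - real n powr g"
  proof eventually_elim
    case (elim \<omega>)
    from elim(1) obtain N where N: "\<And>n. n \<ge> N \<Longrightarrow> \<bar>zeta xi n \<omega>\<bar> \<le> real n powr g"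
      unfolding eventually_sequentially by (auto simp: not_less)
    have tail_eq: "log_ratio n \<omega> = trunc_ratio g n \<omega>" if "n \<ge> N" for n
      using N[OF that] by (simp add: log_ratio_def trunc_ratio_def trunc_def)
    define B where "B = (\<Sum>i<N. \<sigma> * (log_ratio i \<omega> - trunc_ratio g i \<omega>))"
    have "\<sigma> * (\<Sum>i<n. log_ratio i \<omega>) = B + \<sigma> * (\<Sum>i<n. trunc_ratio g i \<omega>)" if "n \<ge> N" for n
    proof -
      have "\<sigma> * (\<Sum>i<n. log_ratio i \<omega>) - \<sigma> * (\<Sum>i<n. trunc_ratio g i \<omega>) =
          (\<Sum>i<n. \<sigma> * (log_ratio i \<omega> - trunc_ratio g i \<omega>))"
        by (simp add: sum_distrib_left sum_subtractf right_diff_distrib)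
      also have "\<dots> = B"
        unfolding B_def using that tail_eq by (intro sum.mono_neutral_right) auto
      finally show ?thesis by simp
    qed
    then have "\<forall>\<^sub>F n in sequentially. \<sigma> * (\<Sum>i<n. log_ratio i \<omega>) = B + \<sigma> * (\<Sum>i<n. trunc_ratio g i \<omega>)"
      unfolding eventually_sequentially by blast
    with elim(2) have "\<forall>\<^sub>F n in sequentially. \<sigma> * (\<Sum>i<n. log_ratio i \<omega>) \<le> B - real n powr g"
    proof eventually_elim
      case (elim n)
      then show ?case by auto
    qed
    then show ?case by blast
  qed
  with g0 show thesis by (rule that)
qed

lemma AE_summable_weight:
  assumes "\<beta> < 1 - 1 / \<alpha>" "\<delta> > 0"
  shows "AE \<omega> in M. summable (\<lambda>n. exp (\<Sum>i<n. log_ratio i \<omega>))"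
proof -
  have "(1 - \<delta>) / (1 + \<delta>) < 1" "(1 - \<delta>) / (1 + \<delta>) > 0"
    using delta assms(2) by (auto simp: divide_simps)
  then have "ln ((1 - \<delta>) / (1 + \<delta>)) < 0"
    by (simp add: ln_less_zero)
  then obtain g where g: "g > 0"
    "AE \<omega> in M. \<exists>B. \<forall>\<^sub>F n in sequentially. 1 * (\<Sum>i<n. log_ratio i \<omega>) \<le> B - real n powr g"
    using AE_drift_dominates[OF assms(1), of 1] by auto
  have sum: "summable (\<lambda>n. exp (- (real n powr g)))"
  proof (rule summable_comparison_test_bigo)
    show "summable (\<lambda>n. norm (real n powr (- 2)))"
      by (simp add: summable_real_powr_iff)
    show "(\<lambda>n. exp (- (real n powr g))) \<in> O(\<lambda>n. real n powr (- 2))"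
      using g(1) by real_asymp
  qed
  from g(2) show ?thesis
  proof eventually_elim
    case (elim \<omega>)
    then obtain B where B: "\<forall>\<^sub>F n in sequentially. 1 * (\<Sum>i<n. log_ratio i \<omega>) \<le> B - real n powr g"
      by blast
    show ?case
    proof (rule summable_comparison_test_ev)
      show "summable (\<lambda>n. exp B * exp (- (real n powr g)))"
        by (rule summable_mult[OF sum])
      show "\<forall>\<^sub>F n in sequentially. norm (exp (\<Sum>i<n. log_ratio i \<omega>)) \<le> exp B * exp (- (real n powr g))"
        using B by eventually_elim (simp flip: exp_add)
    qed
  qed
qed

lemma AE_not_summable_weight_drift:
  assumes "\<beta> < 1 - 1 / \<alpha>" "\<delta> < 0"
  shows "AE \<omega> in M. \<not> summable (\<lambda>n. exp (\<Sum>i<n. log_ratio i \<omega>))"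
proof -
  have "(1 - \<delta>) / (1 + \<delta>) > 1"
    using delta assms(2) by (auto simp: divide_simps)
  then have "ln ((1 - \<delta>) / (1 + \<delta>)) > 0"
    by simp
  then obtain g where g: "g > 0"
    "AE \<omega> in M. \<exists>B. \<forall>\<^sub>F n in sequentially. - 1 * (\<Sum>i<n. log_ratio i \<omega>) \<le> B - real n powr g"
    using AE_drift_dominates[OF assms(1), of "- 1"] by auto
  from g(2) show ?thesis
  proof eventually_elim
    case (elim \<omega>)
    then obtain B where B: "\<forall>\<^sub>F n in sequentially. - 1 * (\<Sum>i<n. log_ratio i \<omega>) \<le> B - real n powr g"
      by blast
    then have "\<forall>\<^sub>F n in sequentially. (\<Sum>i<n. log_ratio i \<omega>) \<ge> - B"
    proof eventually_elim
      case (elim n)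
      have "real n powr g \<ge> 0" by simp
      with elim show ?case by linarith
    qed
    then show ?case
      by (intro not_summable_exp eventually_frequently) auto
  qed
qed

section \<open>Dominating fluctuations\<close>

definition zeta_sum :: "nat \<Rightarrow> 'a \<Rightarrow> real" where
  "zeta_sum n \<omega> = (\<Sum>i<n. (1 - chi i \<omega>) * zeta xi i \<omega>)"

definition zeta_cos :: "real \<Rightarrow> real" where
  "zeta_cos t = expectation (\<lambda>\<omega>. cos (t * zeta xi 0 \<omega>))"

lemma measurable_zeta_sum [measurable]: "zeta_sum n \<in> borel_measurable M"
  unfolding zeta_sum_def by measurable

lemma char_step:
  "char (distr M borel (\<lambda>\<omega>. (1 - chi n \<omega>) * zeta xi n \<omega>)) t = complex_of_real (\<phi> n + (1 - \<phi> n) * zeta_cos t)"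
proof -
  have int: "integrable M (\<lambda>\<omega>. cos (t * zeta xi n \<omega>))" "integrable M (\<lambda>\<omega>. sin (t * zeta xi n \<omega>))"
    "integrable M (\<lambda>\<omega>. 1 - chi n \<omega>)"
    using integrable_chi by (auto intro: integrable_bounded[where B = 1])
  have cos: "indep_var borel (\<lambda>\<omega>. 1 - chi n \<omega>) borel (\<lambda>\<omega>. cos (t * zeta xi n \<omega>))"
    by (rule indep_var_chi_zeta[of "\<lambda>x. 1 - x"]) auto
  have sin: "indep_var borel (\<lambda>\<omega>. 1 - chi n \<omega>) borel (\<lambda>\<omega>. sin (t * zeta xi n \<omega>))"
    by (rule indep_var_chi_zeta[of "\<lambda>x. 1 - x"]) auto
  have "expectation (\<lambda>\<omega>. cos (t * ((1 - chi n \<omega>) * zeta xi n \<omega>))) =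
      expectation (\<lambda>\<omega>. chi n \<omega> + (1 - chi n \<omega>) * cos (t * zeta xi n \<omega>))"
  proof (rule Bochner_Integration.integral_cong[OF refl])
    fix \<omega> assume "\<omega> \<in> space M"
    from chi_values[OF this, of n]
    show "cos (t * ((1 - chi n \<omega>) * zeta xi n \<omega>)) = chi n \<omega> + (1 - chi n \<omega>) * cos (t * zeta xi n \<omega>)"
      by auto
  qed
  also have "\<dots> = \<phi> n + (1 - \<phi> n) * zeta_cos t"
    using indep_var_integrable[OF cos int(3,1)] integrable_chi expectation_zeta[of "\<lambda>x. cos (t * x)" n]
    by (simp add: indep_var_lebesgue_integral[OF cos int(3,1)] expectation_chi prob_space zeta_cos_def)
  finally have 1: "expectation (\<lambda>\<omega>. cos (t * ((1 - chi n \<omega>) * zeta xi n \<omega>))) = \<phi> n + (1 - \<phi> n) * zeta_cos t" .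
  have "expectation (\<lambda>\<omega>. sin (t * ((1 - chi n \<omega>) * zeta xi n \<omega>))) =
      expectation (\<lambda>\<omega>. (1 - chi n \<omega>) * sin (t * zeta xi n \<omega>))"
  proof (rule Bochner_Integration.integral_cong[OF refl])
    fix \<omega> assume "\<omega> \<in> space M"
    from chi_values[OF this, of n]
    show "sin (t * ((1 - chi n \<omega>) * zeta xi n \<omega>)) = (1 - chi n \<omega>) * sin (t * zeta xi n \<omega>)"
      by auto
  qed
  also have "\<dots> = 0"
    using expectation_odd_zeta[of "\<lambda>x. sin (t * x)" n]
    by (simp add: indep_var_lebesgue_integral[OF sin int(3,2)])
  finally have 2: "expectation (\<lambda>\<omega>. sin (t * ((1 - chi n \<omega>) * zeta xi n \<omega>))) = 0" .
  show ?thesis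
    by (simp add: char_distr_eq 1 2 complex_eq_iff)
qed

lemma char_zeta_sum:
  "char (distr M borel (zeta_sum n)) t = complex_of_real (\<Prod>i<n. \<phi> i + (1 - \<phi> i) * zeta_cos t)"
proof -
  have "indep_vars (\<lambda>_. borel) (\<lambda>i \<omega>. (1 - chi i \<omega>) * zeta xi i \<omega>) UNIV"
    unfolding zeta_def
    by (rule indep_vars_chi_xi[of "\<lambda>n x y. (1 - x) * ln (y / (1 - y))"]) measurable
  from char_distr_sum[OF indep_vars_subset[OF this subset_UNIV[of "{..<n}"]], of t]
  show ?thesis
    by (simp add: char_step zeta_sum_def[abs_def])
qed

lemma expectation_cos_zeta_sum:
  "expectation (\<lambda>\<omega>. cos (t * zeta_sum n \<omega>)) = (\<Prod>i<n. \<phi> i + (1 - \<phi> i) * zeta_cos t)"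
  using char_zeta_sum[of n t] by (simp add: char_distr_eq complex_eq_iff del: of_real_prod)

lemma distr_uminus_zeta_sum: "distr M borel (\<lambda>\<omega>. - zeta_sum n \<omega>) = distr M borel (zeta_sum n)"
proof (rule Levy_uniqueness)
  show "char (distr M borel (\<lambda>\<omega>. - zeta_sum n \<omega>)) = char (distr M borel (zeta_sum n))"
    using char_zeta_sum[of n] by (auto simp: char_distr_eq complex_eq_iff fun_eq_iff simp del: of_real_prod)
qed (auto simp: real_distribution_distr)

lemma prob_zeta_sum_gt:
  assumes "a > 0"
  shows "prob {\<omega> \<in> space M. zeta_sum n \<omega> > a} = (1 - prob {\<omega> \<in> space M. \<bar>zeta_sum n \<omega>\<bar> \<le> a}) / 2"
proof -
  have "measure (distr M borel (\<lambda>\<omega>. - zeta_sum n \<omega>)) {a<..} = measure (distr M borel (zeta_sum n)) {a<..}"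
    by (simp only: distr_uminus_zeta_sum)
  then have eq: "prob {\<omega> \<in> space M. - zeta_sum n \<omega> > a} = prob {\<omega> \<in> space M. zeta_sum n \<omega> > a}"
    by (simp add: measure_distr vimage_def Int_def conj_commute)
  have "1 - prob {\<omega> \<in> space M. \<bar>zeta_sum n \<omega>\<bar> \<le> a} = prob {\<omega> \<in> space M. \<not> \<bar>zeta_sum n \<omega>\<bar> \<le> a}"
    by (rule prob_neg[symmetric]) measurable
  also have "{\<omega> \<in> space M. \<not> \<bar>zeta_sum n \<omega>\<bar> \<le> a} =
      {\<omega> \<in> space M. zeta_sum n \<omega> > a} \<union> {\<omega> \<in> space M. - zeta_sum n \<omega> > a}"
    by auto
  also have "prob \<dots> = prob {\<omega> \<in> space M. zeta_sum n \<omega> > a} + prob {\<omega> \<in> space M. - zeta_sum n \<omega> > a}"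
    using assms by (intro finite_measure_Union) auto
  finally show ?thesis using eq by simp
qed

lemma eventually_zeta_cos:
  "\<forall>\<^sub>F t in at_right 0. 0 \<le> zeta_cos t \<and> zeta_cos t \<le> 1 - (1 - cos 1) * (c / 3) * t powr \<alpha>"
proof -
  interpret Z: real_distribution "distr M borel (zeta xi 0)"
    by (simp add: real_distribution_distr)
  have Re: "Re (char (distr M borel (zeta xi 0)) t) = zeta_cos t" for t
    by (simp add: char_distr_eq zeta_cos_def)
  have "(char (distr M borel (zeta xi 0)) \<longlongrightarrow> 1) (at 0)"
    using Z.isCont_char[of 0] by (simp add: isCont_def Z.char_zero)
  from tendsto_Re[OF this] have "(zeta_cos \<longlongrightarrow> 1) (at_right 0)"
    unfolding Re using filterlim_at_split by auto
  then have nonneg: "\<forall>\<^sub>F t in at_right 0. zeta_cos t > 0"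
    by (rule order_tendstoD) simp
  have "\<forall>\<^sub>F t in at_right 0. c / 3 * inverse t powr (- \<alpha>) \<le>
      prob {\<omega> \<in> space M. zeta xi 0 \<omega> \<in> {inverse t<..3 * inverse t}}"
    using prob_annulus_lower filterlim_inverse_at_top_right unfolding filterlim_iff by blast
  with nonneg eventually_at_right_less[of 0] show ?thesis
  proof eventually_elim
    case (elim t)
    let ?A = "{\<omega> \<in> space M. zeta xi 0 \<omega> \<in> {inverse t<..3 * inverse t}}"
    have int: "integrable M (\<lambda>\<omega>. (1 - cos 1) * indicat_real ?A \<omega>)" "integrable M (\<lambda>\<omega>. 1 - cos (t * zeta xi 0 \<omega>))"
      by (auto intro!: integrable_bounded[where B = "2"] split: split_indicator)
    have "(1 - cos 1) * (c / 3) * t powr \<alpha> \<le> (1 - cos 1) * prob ?A"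
      using elim cos_one_less_one by (auto simp: powr_minus inverse_powr)
    also have "\<dots> = expectation (\<lambda>\<omega>. (1 - cos 1) * indicat_real ?A \<omega>)"
      by simp
    also have "\<dots> \<le> expectation (\<lambda>\<omega>. 1 - cos (t * zeta xi 0 \<omega>))"
    proof (rule integral_mono[OF int])
      fix \<omega> assume "\<omega> \<in> space M"
      show "(1 - cos 1) * indicat_real ?A \<omega> \<le> 1 - cos (t * zeta xi 0 \<omega>)"
      proof (cases "\<omega> \<in> ?A")
        case True
        then have "1 \<le> t * zeta xi 0 \<omega>" "t * zeta xi 0 \<omega> \<le> 3"
          using elim by (auto simp: field_simps)
        then have "cos (t * zeta xi 0 \<omega>) \<le> cos 1"
          using pi_gt3 by (intro cos_monotone_0_pi_le) auto
        then show ?thesis using True by simp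
      qed simp
    qed
    also have "\<dots> = 1 - zeta_cos t"
      using integrable_bounded[of "\<lambda>\<omega>. cos (t * zeta xi 0 \<omega>)" 1] by (simp add: zeta_cos_def prob_space)
    finally show ?case using elim by simp
  qed
qed

lemma expectation_cos_zeta_sum_le:
  assumes "0 \<le> zeta_cos t" "zeta_cos t \<le> 1"
  shows "expectation (\<lambda>\<omega>. cos (t * zeta_sum n \<omega>)) \<le> exp (- ((1 - zeta_cos t) * (real n - (\<Sum>i<n. \<phi> i))))"
proof -
  have "(\<Prod>i<n. \<phi> i + (1 - \<phi> i) * zeta_cos t) \<le> (\<Prod>i<n. exp (- ((1 - zeta_cos t) * (1 - \<phi> i))))"
  proof (rule prod_mono, intro conjI)
    fix i
    show "0 \<le> \<phi> i + (1 - \<phi> i) * zeta_cos t"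
      using phi[of i] assms by (intro add_nonneg_nonneg mult_nonneg_nonneg) auto
    show "\<phi> i + (1 - \<phi> i) * zeta_cos t \<le> exp (- ((1 - zeta_cos t) * (1 - \<phi> i)))"
      using exp_ge_add_one_self[of "- ((1 - zeta_cos t) * (1 - \<phi> i))"] by (simp add: algebra_simps)
  qed
  also have "\<dots> = exp (- ((1 - zeta_cos t) * (real n - (\<Sum>i<n. \<phi> i))))"
    by (simp add: exp_sum[symmetric] sum_negf sum_distrib_left[symmetric] sum_subtractf)
  finally show ?thesis by (simp add: expectation_cos_zeta_sum)
qed

lemma expectation_cos_zeta_sum_tendsto:
  assumes g: "0 < g" "g < 1 / \<alpha>" and k: "k > 0" and \<eta>: "\<eta> > 0"
  shows "\<forall>\<^sub>F n in sequentially. expectation (\<lambda>\<omega>. cos (k / real n powr g * zeta_sum n \<omega>)) \<le> \<eta>"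
proof -
  have "filterlim (\<lambda>n. k / real n powr g) (at_right 0) sequentially"
    using g k by real_asymp
  then have cos: "\<forall>\<^sub>F n in sequentially. 0 \<le> zeta_cos (k / real n powr g) \<and>
      zeta_cos (k / real n powr g) \<le> 1 - (1 - cos 1) * (c / 3) * (k / real n powr g) powr \<alpha>"
    using eventually_zeta_cos unfolding filterlim_iff by blast
  define b where "b = 1 - \<beta>"
  have "0 < b" "b < 1" using beta by (auto simp: b_def)
  then have "\<forall>\<^sub>F n in sequentially. 1 + real n powr b / b \<le> real n / 2"
    by real_asymp
  then have phi_sum: "\<forall>\<^sub>F n in sequentially. (\<Sum>i<n. \<phi> i) \<le> real n / 2"
    by eventually_elim (rule order_trans[OF sum_phi_upper], simp add: b_def)
  define \<kappa> e where "\<kappa> = (1 - cos 1) * (c / 3) * k powr \<alpha> / 2" and "e = 1 - g * \<alpha>"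
  have "\<kappa> > 0" using c_pos k cos_one_less_one by (simp add: \<kappa>_def)
  moreover have "e > 0" using g alpha by (simp add: e_def field_simps)
  ultimately have "(\<lambda>n. exp (- (\<kappa> * real n powr e))) \<longlonglongrightarrow> 0"
    by real_asymp
  then have "\<forall>\<^sub>F n in sequentially. exp (- (\<kappa> * real n powr e)) < \<eta>"
    using \<eta> by (rule order_tendstoD)
  with cos phi_sum eventually_gt_at_top[of 0] show ?thesis
  proof eventually_elim
    case (elim n)
    let ?t = "k / real n powr g"
    have "\<kappa> * real n powr e = (1 - cos 1) * (c / 3) * ?t powr \<alpha> * (real n / 2)"
      using elim k by (simp add: \<kappa>_def e_def powr_divide powr_diff powr_powr)
    also have "\<dots> \<le> (1 - zeta_cos ?t) * (real n - (\<Sum>i<n. \<phi> i))"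
    proof (rule mult_mono)
      have "0 \<le> (1 - cos 1) * (c / 3) * ?t powr \<alpha>"
        using c_pos cos_one_less_one by simp
      then show "0 \<le> 1 - zeta_cos ?t" using elim(1) by linarith
    qed (use elim in auto)
    finally have *: "exp (- ((1 - zeta_cos ?t) * (real n - (\<Sum>i<n. \<phi> i)))) \<le> exp (- (\<kappa> * real n powr e))"
      by simp
    have "zeta_cos ?t \<le> 1"
    proof -
      have "0 \<le> (1 - cos 1) * (c / 3) * ?t powr \<alpha>"
        using c_pos cos_one_less_one by simp
      then show ?thesis using elim(1) by linarith
    qed
    with elim(1) have "expectation (\<lambda>\<omega>. cos (?t * zeta_sum n \<omega>)) \<le>
        exp (- ((1 - zeta_cos ?t) * (real n - (\<Sum>i<n. \<phi> i))))"
      by (intro expectation_cos_zeta_sum_le) auto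
    with * elim(4) show ?case by linarith
  qed
qed

lemma prob_chi_sum_ge:
  assumes "a > 0"
  shows "prob {\<omega> \<in> space M. (\<Sum>i<n. chi i \<omega>) \<ge> a} \<le> (1 + real n powr (1 - \<beta>) / (1 - \<beta>)) / a"
proof -
  have "prob {\<omega> \<in> space M. (\<Sum>i<n. chi i \<omega>) \<ge> a} \<le> expectation (\<lambda>\<omega>. \<Sum>i<n. chi i \<omega>) / a"
  proof (rule integral_Markov_inequality_measure[where A = "space M"])
    have "chi i \<omega> \<ge> 0" if "\<omega> \<in> space M" for i \<omega>
      using chi_values[OF that, of i] by auto
    then show "AE \<omega> in M. 0 \<le> (\<Sum>i<n. chi i \<omega>)"
      by (intro AE_I2 sum_nonneg)
  qed (use assms integrable_chi in auto)
  also have "expectation (\<lambda>\<omega>. \<Sum>i<n. chi i \<omega>) = (\<Sum>i<n. \<phi> i)"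
    using integrable_chi by (subst Bochner_Integration.integral_sum) (simp_all add: expectation_chi)
  also have "\<dots> / a \<le> (1 + real n powr (1 - \<beta>) / (1 - \<beta>)) / a"
    using sum_phi_upper assms by (intro divide_right_mono) auto
  finally show ?thesis .
qed

lemma eventually_prob_log_ratio_sum_nonneg:
  assumes \<beta>: "\<beta> > 1 - 1 / \<alpha>"
  shows "\<forall>\<^sub>F n in sequentially. prob {\<omega> \<in> space M. (\<Sum>i<n. log_ratio i \<omega>) \<ge> 0} \<ge> 1 / 8"
proof -
  let ?l = "ln ((1 - \<delta>) / (1 + \<delta>))"
  obtain g where g: "1 - \<beta> < g" "g < 1 / \<alpha>"
    using \<beta> dense[of "1 - \<beta>" "1 / \<alpha>"] by auto
  have g0: "g > 0" using g beta by simp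
  have "\<forall>\<^sub>F n in sequentially. \<forall>m\<in>{1..<8::nat}.
      expectation (\<lambda>\<omega>. cos (real m / 8 / real n powr g * zeta_sum n \<omega>)) \<le> 1 / 64"
    using g0 g by (intro eventually_ball_finite ballI expectation_cos_zeta_sum_tendsto) auto
  moreover
  define l b where "l = \<bar>?l\<bar> + 1" and "b = 1 - \<beta>"
  have "l > 0" "b > 0" "b < g" using beta g by (auto simp: l_def b_def)
  then have "(\<lambda>n. (1 + real n powr b / b) / (real n powr g / l)) \<longlonglongrightarrow> 0"
    by real_asymp
  then have "\<forall>\<^sub>F n in sequentially. (1 + real n powr b / b) / (real n powr g / l) < 1 / 16"
    by (rule order_tendstoD) simp
  ultimately show ?thesis
    using eventually_gt_at_top[of 0]
  proof eventually_elim
    case (elim n)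
    let ?a = "real n powr g"
    have a: "?a > 0" using elim by simp
    have "prob {\<omega> \<in> space M. \<bar>zeta_sum n \<omega>\<bar> \<le> ?a} \<le> 4 / real 8 + 4 * (1 / 64)"
      using elim(1) a by (intro prob_abs_le_cos) (auto simp: field_simps)
    then have T: "prob {\<omega> \<in> space M. zeta_sum n \<omega> > ?a} \<ge> 7 / 32"
      unfolding prob_zeta_sum_gt[OF a] by simp
    have "prob {\<omega> \<in> space M. (\<Sum>i<n. chi i \<omega>) \<ge> ?a / l} \<le> (1 + real n powr (1 - \<beta>) / (1 - \<beta>)) / (?a / l)"
      using a \<open>l > 0\<close> by (intro prob_chi_sum_ge) simp
    also have "\<dots> \<le> 1 / 16"
      using elim(2) by (simp add: b_def)
    finally have D: "prob {\<omega> \<in> space M. (\<Sum>i<n. chi i \<omega>) \<ge> ?a / l} \<le> 1 / 16" .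
    have "{\<omega> \<in> space M. zeta_sum n \<omega> > ?a} \<subseteq> {\<omega> \<in> space M. (\<Sum>i<n. log_ratio i \<omega>) \<ge> 0} \<union>
        {\<omega> \<in> space M. (\<Sum>i<n. chi i \<omega>) \<ge> ?a / l}"
    proof (intro subsetI)
      fix \<omega> assume \<omega>: "\<omega> \<in> {\<omega> \<in> space M. zeta_sum n \<omega> > ?a}"
      show "\<omega> \<in> {\<omega> \<in> space M. (\<Sum>i<n. log_ratio i \<omega>) \<ge> 0} \<union> {\<omega> \<in> space M. (\<Sum>i<n. chi i \<omega>) \<ge> ?a / l}"
      proof (cases "(\<Sum>i<n. chi i \<omega>) \<ge> ?a / l")
        case False
        have nonneg: "(\<Sum>i<n. chi i \<omega>) \<ge> 0"
        proof (rule sum_nonneg)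
          fix i
          show "chi i \<omega> \<ge> 0" using \<omega> chi_values[of \<omega> i] by auto
        qed
        have "\<bar>?l * (\<Sum>i<n. chi i \<omega>)\<bar> \<le> l * (\<Sum>i<n. chi i \<omega>)"
          unfolding abs_mult using nonneg by (auto simp: l_def intro!: mult_right_mono)
        also have "\<dots> \<le> ?a"
          using False \<open>l > 0\<close> by (simp add: field_simps)
        finally have "?l * (\<Sum>i<n. chi i \<omega>) + zeta_sum n \<omega> \<ge> 0"
          using \<omega> by auto
        then have "(\<Sum>i<n. log_ratio i \<omega>) \<ge> 0"
          by (simp add: log_ratio_def sum.distrib zeta_sum_def sum_distrib_left)
        then show ?thesis using \<omega> by simp
      qed (use \<omega> in auto)
    qed
    then have "prob {\<omega> \<in> space M. zeta_sum n \<omega> > ?a} \<le> prob ({\<omega> \<in> space M. (\<Sum>i<n. log_ratio i \<omega>) \<ge> 0} \<union>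
        {\<omega> \<in> space M. (\<Sum>i<n. chi i \<omega>) \<ge> ?a / l})"
      by (intro finite_measure_mono) auto
    also have "\<dots> \<le> prob {\<omega> \<in> space M. (\<Sum>i<n. log_ratio i \<omega>) \<ge> 0} +
        prob {\<omega> \<in> space M. (\<Sum>i<n. chi i \<omega>) \<ge> ?a / l}"
      by (intro measure_Un_le) auto
    finally show ?case using T D by simp
  qed
qed

definition not_drifting_down :: "'a set" where
  "not_drifting_down =
     {\<omega> \<in> space M. \<exists>K::nat. \<forall>m. \<exists>n\<ge>m. (\<Sum>i<n. log_ratio i \<omega>) \<ge> - real K}"

lemma not_drifting_down_shift:
  "not_drifting_down =
     {\<omega> \<in> space M. \<exists>K::nat. \<forall>m. \<exists>n. m \<le> n \<and> (\<Sum>i\<in>{k..<k + n}. log_ratio i \<omega>) \<ge> - real K}"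
proof -
  have sum_split: "(\<Sum>i<k + n. log_ratio i \<omega>) = (\<Sum>i<k. log_ratio i \<omega>) + (\<Sum>i\<in>{k..<k + n}. log_ratio i \<omega>)" for \<omega> n
    using sum.atLeastLessThan_concat[of 0 k "k + n" "\<lambda>i. log_ratio i \<omega>"] by (simp add: atLeast0LessThan)
  have "(\<exists>K::nat. \<forall>m. \<exists>n\<ge>m. (\<Sum>i<n. log_ratio i \<omega>) \<ge> - real K) \<longleftrightarrow>
      (\<exists>K::nat. \<forall>m. \<exists>n. m \<le> n \<and> (\<Sum>i\<in>{k..<k + n}. log_ratio i \<omega>) \<ge> - real K)" for \<omega>
  proof
    assume "\<exists>K::nat. \<forall>m. \<exists>n\<ge>m. (\<Sum>i<n. log_ratio i \<omega>) \<ge> - real K"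
    then obtain K :: nat where K: "\<And>m. \<exists>n\<ge>m. (\<Sum>i<n. log_ratio i \<omega>) \<ge> - real K"
      by blast
    obtain L :: nat where L: "real K + (\<Sum>i<k. log_ratio i \<omega>) \<le> real L"
      using real_arch_simple by blast
    have "\<exists>n. m \<le> n \<and> (\<Sum>i\<in>{k..<k + n}. log_ratio i \<omega>) \<ge> - real L" for m
    proof -
      obtain n where n: "n \<ge> k + m" "(\<Sum>i<n. log_ratio i \<omega>) \<ge> - real K"
        using K by blast
      then obtain j where "n = k + j" "m \<le> j"
        by (metis add_le_cancel_left le_Suc_ex add_leD1)
      then show ?thesis
        using n L sum_split[of \<omega> j] by (intro exI[of _ j]) auto
    qed
    then show "\<exists>K::nat. \<forall>m. \<exists>n. m \<le> n \<and> (\<Sum>i\<in>{k..<k + n}. log_ratio i \<omega>) \<ge> - real K"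
      by blast
  next
    assume "\<exists>K::nat. \<forall>m. \<exists>n. m \<le> n \<and> (\<Sum>i\<in>{k..<k + n}. log_ratio i \<omega>) \<ge> - real K"
    then obtain K :: nat where K: "\<And>m. \<exists>n. m \<le> n \<and> (\<Sum>i\<in>{k..<k + n}. log_ratio i \<omega>) \<ge> - real K"
      by blast
    obtain L :: nat where L: "real K - (\<Sum>i<k. log_ratio i \<omega>) \<le> real L"
      using real_arch_simple by blast
    have "\<exists>n\<ge>m. (\<Sum>i<n. log_ratio i \<omega>) \<ge> - real L" for m
    proof -
      obtain n where n: "m \<le> n" "(\<Sum>i\<in>{k..<k + n}. log_ratio i \<omega>) \<ge> - real K"
        using K by blast
      then show ?thesis
        using L sum_split[of \<omega> n] by (intro exI[of _ "k + n"]) auto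
    qed
    then show "\<exists>K::nat. \<forall>m. \<exists>n\<ge>m. (\<Sum>i<n. log_ratio i \<omega>) \<ge> - real K"
      by blast
  qed
  then show ?thesis
    unfolding not_drifting_down_def by blast
qed

lemma prob_not_drifting_down_0_1: "prob not_drifting_down = 0 \<or> prob not_drifting_down = 1"
proof (rule kolmogorov_0_1_law)
  define A where "A i = sigma_sets (space M) {log_ratio i -` B \<inter> space M |B. B \<in> sets borel}" for i
  show sa: "sigma_algebra (space M) (A i)" for i
    unfolding A_def by (rule sigma_algebra_sigma_sets) auto
  show "indep_sets A UNIV"
    using indep_vars_log_ratio unfolding indep_vars_def A_def[abs_def] by blast
  show "not_drifting_down \<in> tail_events A"
    unfolding tail_events_def
  proof
    fix k
    define N where "N = sigma (space M) (\<Union>(A ` {k..}))"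
    have sub: "\<Union>(A ` {k..}) \<subseteq> Pow (space M)"
      using sigma_algebra_iff2[THEN iffD1, OF sa] by blast
    have N: "space N = space M" "sets N = sigma_sets (space M) (\<Union>(A ` {k..}))"
      using sub by (simp_all add: N_def space_measure_of sets_measure_of)
    have meas: "log_ratio i \<in> borel_measurable N" if "i \<ge> k" for i
    proof (rule measurableI)
      fix B :: "real set" assume "B \<in> sets borel"
      then have "log_ratio i -` B \<inter> space M \<in> A i"
        unfolding A_def by (intro sigma_sets.Basic) blast
      then show "log_ratio i -` B \<inter> space N \<in> sets N"
        unfolding N using that by (intro sigma_sets.Basic) auto
    qed simp
    have [measurable]: "(\<lambda>\<omega>. \<Sum>i\<in>{k..<k + n}. log_ratio i \<omega>) \<in> borel_measurable N" for n
      by (intro borel_measurable_sum meas) auto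
    have "{\<omega> \<in> space N. \<exists>K::nat. \<forall>m. \<exists>n. m \<le> n \<and> (\<Sum>i\<in>{k..<k + n}. log_ratio i \<omega>) \<ge> - real K} \<in> sets N"
      by measurable
    then show "not_drifting_down \<in> sigma_sets (space M) (\<Union>(A ` {k..}))"
      unfolding N not_drifting_down_shift[of k] .
  qed
qed

lemma sets_not_drifting_down: "not_drifting_down \<in> events"
proof -
  have "{\<omega> \<in> space M. \<exists>K::nat. \<forall>m. \<exists>n. m \<le> n \<and> (\<Sum>i<n. log_ratio i \<omega>) \<ge> - real K} \<in> events"
    by measurable
  then show ?thesis by (simp add: not_drifting_down_def)
qed

lemma AE_not_summable_weight_fluctuation:
  assumes "\<beta> > 1 - 1 / \<alpha>"
  shows "AE \<omega> in M. \<not> summable (\<lambda>n. exp (\<Sum>i<n. log_ratio i \<omega>))"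
proof -
  let ?S = "\<lambda>n \<omega>. \<Sum>i<n. log_ratio i \<omega>"
  obtain N where N: "\<And>n. n \<ge> N \<Longrightarrow> prob {\<omega> \<in> space M. ?S n \<omega> \<ge> 0} \<ge> 1 / 8"
    using eventually_prob_log_ratio_sum_nonneg[OF assms] unfolding eventually_sequentially by blast
  let ?U = "\<lambda>m. {\<omega> \<in> space M. \<exists>n. m \<le> n \<and> ?S n \<omega> \<ge> 0}"
  have U: "?U m \<in> events" for m
    by measurable
  have "(\<lambda>m. prob (?U m)) \<longlonglongrightarrow> prob (\<Inter>m. ?U m)"
    using U by (intro finite_Lim_measure_decseq) (auto simp: decseq_def intro: order_trans)
  moreover have "1 / 8 \<le> prob (?U m)" for m
  proof -
    have "1 / 8 \<le> prob {\<omega> \<in> space M. ?S (max m N) \<omega> \<ge> 0}"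
      by (rule N) simp
    also have "\<dots> \<le> prob (?U m)"
      using U by (intro finite_measure_mono) (auto intro: exI[of _ "max m N"])
    finally show ?thesis .
  qed
  ultimately have "1 / 8 \<le> prob (\<Inter>m. ?U m)"
    by (intro LIMSEQ_le_const) auto
  also have "\<dots> \<le> prob not_drifting_down"
  proof (intro finite_measure_mono sets_not_drifting_down subsetI)
    fix \<omega> assume "\<omega> \<in> (\<Inter>m. ?U m)"
    then have "\<omega> \<in> space M" "\<forall>m. \<exists>n\<ge>m. ?S n \<omega> \<ge> - real 0"
      by auto
    then show "\<omega> \<in> not_drifting_down"
      unfolding not_drifting_down_def by blast
  qed
  finally have "prob not_drifting_down = 1"
    using prob_not_drifting_down_0_1 by auto
  then have "AE \<omega> in M. \<omega> \<in> not_drifting_down"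
    using sets_not_drifting_down by (simp add: prob_eq_1)
  then show ?thesis
  proof eventually_elim
    case (elim \<omega>)
    then obtain K :: nat where "\<And>m. \<exists>n\<ge>m. ?S n \<omega> \<ge> - real K"
      unfolding not_drifting_down_def by blast
    then have "\<exists>\<^sub>F n in sequentially. ?S n \<omega> \<ge> - real K"
      by (auto simp: frequently_sequentially)
    then show ?case by (rule not_summable_exp)
  qed
qed

lemma nearest_neighbour_walk_env: "\<omega> \<in> space M \<Longrightarrow> nearest_neighbour_walk (env \<delta> chi xi \<omega>)"
  using env_bounds by unfold_locales

lemma weight_env:
  assumes "\<omega> \<in> space M"
  shows "nearest_neighbour_walk.weight (env \<delta> chi xi \<omega>) = (\<lambda>n. exp (\<Sum>i<n. log_ratio i \<omega>))"
  using nearest_neighbour_walk.weight_def[OF nearest_neighbour_walk_env[OF assms]]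
  by (auto simp: exp_log_ratio[OF assms] exp_sum)

lemma AE_recurrent:
  assumes "AE \<omega> in M. \<not> summable (\<lambda>n. exp (\<Sum>i<n. log_ratio i \<omega>))"
  shows "AE \<omega> in M. recurrent_chain (walk_kernel (env \<delta> chi xi \<omega>))"
  using assms AE_space
  by eventually_elim
    (simp add: nearest_neighbour_walk.recurrent_walk nearest_neighbour_walk_env weight_env)

lemma AE_transient:
  assumes "AE \<omega> in M. summable (\<lambda>n. exp (\<Sum>i<n. log_ratio i \<omega>))"
  shows "AE \<omega> in M. transient_chain (walk_kernel (env \<delta> chi xi \<omega>))"
  using assms AE_space
  by eventually_elim
    (simp add: nearest_neighbour_walk.transient_walk nearest_neighbour_walk_env weight_env)

end

theorem theorem2p3:
  fixes M :: "'a measure" and \<delta> \<alpha> \<beta> c :: real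
    and \<phi> :: "nat \<Rightarrow> real" and chi xi :: "nat \<Rightarrow> 'a \<Rightarrow> real"
  assumes "mixed_environment M \<delta> \<phi> chi xi"
    and "\<And>x. x \<ge> 0 \<Longrightarrow>
      measure M {\<omega> \<in> space M. zeta xi 0 \<omega> \<le> - x} = measure M {\<omega> \<in> space M. zeta xi 0 \<omega> \<ge> x}"
    and "1 < \<alpha>" "\<alpha> < 2" "0 < c"
    and "(\<lambda>r. measure M {\<omega> \<in> space M. zeta xi 0 \<omega> > r}) \<sim>[at_top] (\<lambda>r. c * r powr (- \<alpha>))"
    and "0 < \<beta>" "\<beta> < 1"
    and "\<And>n. n \<ge> 1 \<Longrightarrow> \<phi> n = real n powr (- \<beta>)"
  shows "(\<beta> < 1 - 1 / \<alpha> \<longrightarrow>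
           (\<delta> < 0 \<longrightarrow> (AE \<omega> in M. recurrent_chain (walk_kernel (env \<delta> chi xi \<omega>)))) \<and>
           (\<delta> > 0 \<longrightarrow> (AE \<omega> in M. transient_chain (walk_kernel (env \<delta> chi xi \<omega>))))) \<and>
         (\<beta> > 1 - 1 / \<alpha> \<longrightarrow>
           (AE \<omega> in M. recurrent_chain (walk_kernel (env \<delta> chi xi \<omega>))))"
proof -
  interpret mixed_environment M \<delta> \<phi> chi xi by fact
  interpret heavy_tailed_environment M \<delta> \<phi> chi xi \<alpha> \<beta> c
    by unfold_locales (fact assms)+
  show ?thesis
    using AE_recurrent[OF AE_not_summable_weight_drift] AE_transient[OF AE_summable_weight]
      AE_recurrent[OF AE_not_summable_weight_fluctuation] by blast
qed

end
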